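(* Let $f:\mathbb{R}^2\to\mathbb{R}$ be a polynomial function with $f(0,0)=0$ and with a strict local minimum at the origin $O$. Let $\Gamma=\Gamma(f,x):=\{(x,y)\in\mathbb{R}^2\mid \frac{\partial f}{\partial y}(x,y)=0\}$ be its polar curve with respect to $x$, and let $\phi:\mathbb{R}^2_{x,y}\to\mathbb{R}^2_{x,z}$, $\phi(x,y):=(x,f(x,y))$. Suppose that (a) the polar curve $\Gamma$ is reduced, and (b) the restriction of $\phi$ to $\Gamma$ is a homeomorphism onto its image $\phi(\Gamma)$. Then, for all sufficiently small $\varepsilon>0$, the shape of $\mathcal{C}_\varepsilon$ in the half-plane $x>0$ is encoded by an alternating permutation (a snake): the relations $<_1$ and $<_2$ described in the context are total orders on the set of right crests and right valleys of $\mathcal{C}_\varepsilon$, and the permutation associated to the pair $(<_1,<_2)$ is a snake.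
   Context: For $\varepsilon>0$, $\mathcal{D}_\varepsilon$ is the connected component containing the origin $O$ of $f^{-1}([0,\varepsilon])$, and $\mathcal{C}_\varepsilon:=\mathcal{D}_\varepsilon\setminus\mathrm{Int}\,\mathcal{D}_\varepsilon$. For all sufficiently small $\varepsilon>0$, $\mathcal{C}_\varepsilon$ is a smooth Jordan curve. The polar curve is reduced if its equation $\frac{\partial f}{\partial y}$ has no factor of multiplicity greater than one. Polar half-branches: in a sufficiently small neighbourhood $V$ of $O$, $(\Gamma\cap V)\setminus\{O\}$ is a finite disjoint union of half-branches issuing from $O$, called polar half-branches; those in $\{x>0\}$ are called right polar half-branches. In $V$, distinct polar half-branches meet only at $O$, and for sufficiently small $\varepsilon>0$ each of them meets $\mathcal{C}_\varepsilon$ in exactly one point. The right polar half-branches are totally ordered by the trigonometric (counterclockwise) order in the half-plane $x>0$: $\gamma_1^+<\dots<\gamma_n^+$. Put $P_i=(x_i,y_i):=\mathcal{C}_\varepsilon\cap\gamma_i^+$. The point $P_i$ is a right crest (respectively right valley) of $\mathcal{C}_\varepsilon$ if, in a small enough neighbourhood of $P_i$, $\mathcal{C}_\varepsilon$ is situated to the right (respectively to the left) of the vertical line $x=x_i$. The two orders on $\{P_1,\dots,P_n\}$: $<_1$ is the order of the right polar half-branches, $P_1<_1P_2<_1\dots<_1P_n$; $<_2$ is the order given by the $x$-coordinate read from right to left, i.e. $P_i<_2P_j$ if and only if $x_i>x_j$. The permutation associated to $(<_1,<_2)$ is $\sigma:\{1,\dots,n\}\to\{1,\dots,n\}$, where $\sigma(i)$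 is the position in the order $<_2$ of the element which is in position $i$ in the order $<_1$. A permutation $\sigma$ of $\{1,\dots,n\}$ is a snake if it is alternating: $\sigma(1)>\sigma(2)<\sigma(3)>\dots$ or $\sigma(1)<\sigma(2)>\sigma(3)<\dots$. *)

theory Defs
  imports "HOL-Analysis.Analysis" "HOL-Computational_Algebra.Squarefree"
begin

text \<open>
  Points of the plane are pairs of type \<^typ>\<open>real \<times> real\<close>, whose norm is the Euclidean one.  A polynomial
  in \<open>\<real>[x,y]\<close> is represented as \<open>F :: real poly poly\<close>, a polynomial in \<open>y\<close> whose coefficients are
  polynomials in \<open>x\<close>; thus \<^term>\<open>pderiv F\<close> is its partial derivative with respect to \<open>y\<close>.
\<close>

definition poly_xy :: "real poly poly \<Rightarrow> real \<times> real \<Rightarrow> real" where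
  "poly_xy F = (\<lambda>(x, y). poly (poly F [:y:]) x)"

definition polar_curve :: "(real \<times> real \<Rightarrow> real) \<Rightarrow> (real \<times> real) set" where
  "polar_curve f = {(x, y). deriv (\<lambda>t. f (x, t)) y = 0}"

lemma poly_xy_has_deriv_y:
  "((\<lambda>t. poly_xy F (x, t)) has_real_derivative poly_xy (pderiv F) (x, y)) (at y)"
proof (induction F)
  case 0
  then show ?case by (simp add: poly_xy_def)
next
  case (pCons a F)
  have "((\<lambda>t. poly a x + t * poly_xy F (x, t)) has_real_derivative
      poly_xy F (x, y) + y * poly_xy (pderiv F) (x, y)) (at y)"
    by (auto intro!: derivative_eq_intros pCons.IH)
  then show ?case by (simp add: poly_xy_def pderiv_pCons)
qed

lemma polar_curve_poly_xy: "polar_curve (poly_xy F) = {p. poly_xy (pderiv F) p = 0}"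
  by (auto simp: polar_curve_def DERIV_imp_deriv[OF poly_xy_has_deriv_y])

definition polar_map :: "(real \<times> real \<Rightarrow> real) \<Rightarrow> real \<times> real \<Rightarrow> real \<times> real" where
  "polar_map f = (\<lambda>(x, y). (x, f (x, y)))"

definition strict_local_min :: "(real \<times> real \<Rightarrow> real) \<Rightarrow> real \<times> real \<Rightarrow> bool" where
  "strict_local_min f p \<longleftrightarrow> (\<forall>\<^sub>F q in at p. f p < f q)"

definition level_disc :: "(real \<times> real \<Rightarrow> real) \<Rightarrow> real \<Rightarrow> (real \<times> real) set" where
  "level_disc f \<epsilon> = connected_component_set (f -` {0..\<epsilon>}) (0, 0)"

definition level_curve :: "(real \<times> real \<Rightarrow> real) \<Rightarrow> real \<Rightarrow> (real \<times> real) set" where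
  "level_curve f \<epsilon> = level_disc f \<epsilon> - interior (level_disc f \<epsilon>)"

text \<open>
  The neighbourhood \<open>V\<close> of the origin is the disc of radius \<open>r\<close>, to be taken small enough.  The half-branches
  are connected, and each is open in their finite disjoint union \<open>(\<Gamma> \<inter> V) - {O}\<close>, so they are exactly
  the connected components of that set.
\<close>

definition polar_half_branches :: "(real \<times> real \<Rightarrow> real) \<Rightarrow> real \<Rightarrow> (real \<times> real) set set" where
  "polar_half_branches f r = components (polar_curve f \<inter> ball (0, 0) r - {(0, 0)})"

definition right_polar_half_branches :: "(real \<times> real \<Rightarrow> real) \<Rightarrow> real \<Rightarrow> (real \<times> real) set set" where
  "right_polar_half_branches f r = {H \<in> polar_half_branches f r. H \<subseteq> {p. 0 < fst p}}"

text \<open>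
  The counterclockwise order of half-branches in the half-plane \<open>x > 0\<close> is read off on small circles
  around the origin, each of which meets a half-branch exactly once.  In that half-plane \<^const>\<open>Arg\<close>
  takes its values in \<open>(-\<pi>/2, \<pi>/2)\<close>.
\<close>

definition trig_less :: "(real \<times> real) set \<Rightarrow> (real \<times> real) set \<Rightarrow> bool" where
  "trig_less A B \<longleftrightarrow> (\<forall>\<^sub>F t in at_right 0. \<exists>p q. A \<inter> sphere (0, 0) t = {p} \<and> B \<inter> sphere (0, 0) t = {q} \<and>
     Arg (Complex (fst p) (snd p)) < Arg (Complex (fst q) (snd q)))"

definition right_crest :: "(real \<times> real) set \<Rightarrow> real \<times> real \<Rightarrow> bool" where
  "right_crest C p \<longleftrightarrow> p \<in> C \<and> 0 < fst p \<and> (\<forall>\<^sub>F q in at p within C. fst p < fst q)"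

definition right_valley :: "(real \<times> real) set \<Rightarrow> real \<times> real \<Rightarrow> bool" where
  "right_valley C p \<longleftrightarrow> p \<in> C \<and> 0 < fst p \<and> (\<forall>\<^sub>F q in at p within C. fst q < fst p)"

definition branch_order :: "nat \<Rightarrow> (nat \<Rightarrow> real \<times> real) \<Rightarrow> ((real \<times> real) \<times> (real \<times> real)) set" where
  "branch_order n P = {(P i, P j) | i j. i \<in> {1..n} \<and> j \<in> {1..n} \<and> i < j}"

text \<open>Reading from right to left: the larger abscissa comes first.\<close>

definition abscissa_order :: "nat \<Rightarrow> (nat \<Rightarrow> real \<times> real) \<Rightarrow> ((real \<times> real) \<times> (real \<times> real)) set" where
  "abscissa_order n P = {(P i, P j) | i j. i \<in> {1..n} \<and> j \<in> {1..n} \<and> fst (P i) > fst (P j)}"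

text \<open>Positions in a finite strictly ordered set \<open>(A, R)\<close> are counted from \<open>1\<close>.\<close>

definition order_position :: "'a set \<Rightarrow> ('a \<times> 'a) set \<Rightarrow> 'a \<Rightarrow> nat" where
  "order_position A R a = card {b \<in> A. (b, a) \<in> R} + 1"

definition assoc_permutation :: "'a set \<Rightarrow> ('a \<times> 'a) set \<Rightarrow> ('a \<times> 'a) set \<Rightarrow> nat \<Rightarrow> nat" where
  "assoc_permutation A R1 R2 i = order_position A R2 (THE a. a \<in> A \<and> order_position A R1 a = i)"

definition snake :: "nat \<Rightarrow> (nat \<Rightarrow> nat) \<Rightarrow> bool" where
  "snake n \<sigma> \<longleftrightarrow> bij_betw \<sigma> {1..n} {1..n} \<and>
     ((\<forall>i. 1 \<le> i \<and> i < n \<longrightarrow> (if odd i then \<sigma> i > \<sigma> (i + 1) else \<sigma> i < \<sigma> (i + 1))) \<or>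
      (\<forall>i. 1 \<le> i \<and> i < n \<longrightarrow> (if odd i then \<sigma> i < \<sigma> (i + 1) else \<sigma> i > \<sigma> (i + 1))))"

end

theory Submission
  imports Defs "HOL-Computational_Algebra.Polynomial_Factorial" "HOL-Computational_Algebra.Field_as_Ring"
begin

text \<open>
  Write \<open>f\<close> for the polynomial function \<^term>\<open>poly_xy F\<close>, with \<open>f\<^sub>y\<close> given by \<^term>\<open>pderiv F\<close>.  The idea is to
  read the shape of a small level curve from the functions \<open>y \<mapsto> f(x, y)\<close>, with \<open>x > 0\<close> small.

  Over a small interval \<open>(0, \<delta>)\<close> the part of the polar curve near the origin consists of disjoint
  graphs \<open>y = Y\<^sub>1(x) < \<dots> < Y\<^sub>n(x)\<close> that tend to the origin; these are the right half-branches.  As the polar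
  curve is reduced, \<open>f\<^sub>y\<close> and \<open>f\<^sub>y\<^sub>y\<close> have no common zero over \<open>(0, \<delta>)\<close>, so each \<open>Y\<^sub>i(x)\<close> is a nondegenerate
  critical point of \<open>f(x, \<cdot>)\<close>, and consecutive ones are alternately minima and maxima
  (\<open>consecutive_branches\<close>).  Hence the heights \<open>h\<^sub>i(x) = f(x, Y\<^sub>i(x))\<close> satisfy \<open>h\<^sub>1 < h\<^sub>2 > h\<^sub>3 < \<dots>\<close> or
  \<open>h\<^sub>1 > h\<^sub>2 < h\<^sub>3 > \<dots>\<close>, with the same pattern for all \<open>x\<close>.

  Along a half-branch the height increases strictly from \<open>0\<close>.  Therefore the level curve of height \<open>\<epsilon>\<close>
  meets the \<open>i\<close>-th half-branch in the single point of abscissa \<open>x\<^sub>i = h\<^sub>i\<inverse>(\<epsilon>)\<close>, and a larger height function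
  reaches \<open>\<epsilon>\<close> at a smaller abscissa: the numbers \<open>x\<^sub>i\<close> alternate because the heights do.  They are
  pairwise distinct because the polar map separates the points of the polar curve.  At these points
  \<open>f\<^sub>x > 0\<close> and \<open>f\<^sub>y\<^sub>y \<noteq> 0\<close>, so the level curve turns back there and the point is a valley or a crest
  according to the sign of \<open>f\<^sub>y\<^sub>y\<close>.  At every other point of the level curve with \<open>x > 0\<close> one has
  \<open>f\<^sub>y \<noteq> 0\<close>, the curve runs on to both sides of the vertical line, and there is neither a crest
  nor a valley.

  Monotonicity near the origin rests on polynomial identities, without Puiseux series or curve
  selection: along a branch, a polynomial either vanishes identically near \<open>0\<close> or has no zero near \<open>0\<close>
  (\<open>zero_or_nonzero_along_branch\<close>).  Applied to the numerators of the derivatives of the height and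
  of the squared distance to the origin, this shows that both functions are increasing
  (\<open>increasing_along_branch\<close>).  The second of them makes each half-branch connected inside small
  discs and makes it meet each small circle exactly once.
\<close>


section \<open>Common zeros and polynomial combinations\<close>

text \<open>
  Gauss's lemma: over the fraction field the factor \<open>c\<close> is a unit.
\<close>

lemma primitive_dvd_smultD:
  fixes p q :: "real poly poly"
  assumes "p dvd smult c q" and "c \<noteq> 0" and "content p = 1"
  shows "p dvd q"
proof (rule fract_poly_dvdD)
  have "fract_poly p dvd smult (to_fract c) (fract_poly q)"
    using fract_poly_dvd[OF assms(1)] by simp
  then show "fract_poly p dvd fract_poly q"
    using \<open>c \<noteq> 0\<close> by (simp add: dvd_smult_iff)
qed (fact assms(3))

text \<open>
  Bezout's identity fails in \<open>\<real>[x][y]\<close>, but it holds up to a nonzero polynomial \<open>c(x)\<close>: an element \<open>d\<close> of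
  least degree in \<open>y\<close> of the ideal generated by \<open>p\<close> and \<open>q\<close> divides, by pseudo-division, multiples
  \<open>c'(x) p\<close> and \<open>c''(x) q\<close>.  By Gauss's lemma its primitive part is then a common divisor, so that \<open>d\<close> has degree
  \<open>0\<close> in \<open>y\<close>.  Common divisors in \<open>\<real>[x]\<close> are harmless, which matters because they need not be units.
\<close>

lemma bezout_poly_poly:
  fixes p q :: "real poly poly"
  assumes p: "p \<noteq> 0" and common: "\<And>d. d dvd p \<Longrightarrow> d dvd q \<Longrightarrow> degree d = 0"
  shows "\<exists>a b c. c \<noteq> 0 \<and> a * p + b * q = [:c:]"
proof -
  define I where "I = {d. d \<noteq> 0 \<and> (\<exists>a b. d = a * p + b * q)}"
  have "p = 1 * p + 0 * q" by simp
  with p have pI: "p \<in> I" unfolding I_def by blast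
  define d where "d = arg_min degree (\<lambda>d. d \<in> I)"
  have dI: "d \<in> I" and dmin: "\<And>e. e \<in> I \<Longrightarrow> degree d \<le> degree e"
    unfolding d_def using arg_min_nat_lemma[of "\<lambda>d. d \<in> I", OF pI] by blast+
  have d0: "d \<noteq> 0" using dI by (simp add: I_def)
  from dI obtain a b where ab: "d = a * p + b * q" by (auto simp: I_def)
  have div: "\<exists>c. c \<noteq> 0 \<and> d dvd smult c e" if "e = a' * p + b' * q" for e a' b'
  proof -
    obtain k r where kr: "pseudo_divmod e d = (k, r)" by fastforce
    define c where "c = coeff d (degree d) ^ (Suc (degree e) - degree d)"
    have c: "c \<noteq> 0" using d0 by (simp add: c_def)
    have eq: "smult c e = d * k + r" and r: "r = 0 \<or> degree r < degree d"
      using pseudo_divmod[OF d0 kr] by (auto simp: c_def)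
    have "r = (smult c a' - k * a) * p + (smult c b' - k * b) * q"
      using eq unfolding that ab by (simp add: algebra_simps smult_add_right)
    then have "r \<in> I \<or> r = 0" unfolding I_def by blast
    with r dmin have "r = 0" by force
    with eq c show ?thesis by (metis add.right_neutral dvd_triv_left)
  qed
  have dvd: "primitive_part d dvd e" if "e = a' * p + b' * q" for e a' b'
  proof -
    from div[OF that] obtain c where c: "c \<noteq> 0" "d dvd smult c e" by blast
    have "primitive_part d dvd d"
      by (metis content_times_primitive_part dvd_refl dvd_smult)
    with c show ?thesis
      using d0 primitive_dvd_smultD[of "primitive_part d" c e] by (auto intro: dvd_trans)
  qed
  have "degree (primitive_part d) = 0"
    by (rule common; rule dvd[of _ 1 0] dvd[of _ 0 1]; simp)
  then obtain c where "d = [:c:]" by (auto elim: degree_eq_zeroE)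
  with d0 ab show ?thesis by (intro exI[of _ a] exI[of _ b] exI[of _ c]) auto
qed

text \<open>
  The prime is taken from the primitive part: a prime factor of degree \<open>0\<close> would divide its
  content, which is \<open>1\<close>.
\<close>

lemma prime_factor_pos_degree:
  fixes p :: "real poly poly"
  assumes "degree p > 0"
  obtains q where "prime q" "q dvd p" "degree q > 0"
proof -
  have p0: "p \<noteq> 0" using assms by auto
  have "\<not> is_unit (primitive_part p)"
    using assms by (auto simp: is_unit_poly_iff dest!: arg_cong[of _ _ degree])
  then obtain q where q: "prime q" "q dvd primitive_part p"
    using p0 prime_divisor_exists[of "primitive_part p"] by auto
  have "degree q > 0"
  proof (rule ccontr)
    assume "\<not> degree q > 0"
    then obtain c where c: "q = [:c:]" by (auto elim: degree_eq_zeroE)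
    have "content q dvd content (primitive_part p)" using q by blast
    then have "is_unit c" using p0 c by simp
    then show False using q(1) c by (metis is_unit_const_poly_iff not_prime_unit)
  qed
  moreover have "q dvd p"
    using q(2) by (metis content_times_primitive_part dvd_smult)
  ultimately show ?thesis using q(1) that by blast
qed

text \<open>
  A prime of positive degree that divides \<open>p\<close> and its derivative divides \<open>p\<close> twice, as over a field of
  characteristic zero.
\<close>

lemma squarefree_bezout_pderiv:
  fixes p :: "real poly poly"
  assumes "squarefree p"
  shows "\<exists>a b c. c \<noteq> 0 \<and> a * p + b * pderiv p = [:c:]"
proof (rule bezout_poly_poly)
  show "p \<noteq> 0" using assms by auto
  fix d assume d: "d dvd p" "d dvd pderiv p"
  show "degree d = 0"
  proof (rule ccontr)
    assume "degree d \<noteq> 0"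
    then obtain q where q: "prime q" "q dvd d" "degree q > 0"
      using prime_factor_pos_degree[of d] by auto
    from q d obtain h where h: "p = q * h" by (meson dvdE dvd_trans)
    have "q dvd pderiv (q * h)" using q d h dvd_trans by metis
    then have "q dvd pderiv q * h"
      by (metis dvd_add_right_iff dvd_triv_left mult.commute pderiv_mult)
    then have "q dvd pderiv q \<or> q dvd h"
      using q(1) by (simp add: prime_dvd_mult_iff)
    moreover have "\<not> q dvd pderiv q"
      using q(3) by (metis degree_pderiv dvd_imp_degree_le leD pderiv_eq_0_iff diff_less less_numeral_extra(1) less_irrefl)
    ultimately have "q ^ 2 dvd p" using h by (simp add: power2_eq_square)
    then have "is_unit q" using assms squarefreeD by blast
    then show False using q(1) by (auto simp: prime_def)
  qed
qed

text \<open>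
  Take \<open>d\<close> to be the gcd of \<open>p\<close> and \<open>q\<close>.  A common factor of \<open>e\<close> with \<open>q\<close> would divide \<open>d\<close> as well, and
  its square would divide \<open>p\<close>.  On the zeros of \<open>p\<close> over a small \<open>x > 0\<close>, the polynomial \<open>q\<close> thus vanishes
  exactly on those of the factor \<open>d\<close>.
\<close>

lemma squarefree_split_bezout:
  fixes p q :: "real poly poly"
  assumes "squarefree p"
  obtains d e where "p = d * e" "d dvd q"
    "\<exists>a b c. c \<noteq> 0 \<and> a * d + b * e = [:c:]"
    "\<exists>a b c. c \<noteq> 0 \<and> a * e + b * q = [:c:]"
proof -
  define d where "d = gcd p q"
  have p0: "p \<noteq> 0" using assms by auto
  obtain e where e: "p = d * e" unfolding d_def by (meson dvdE gcd_dvd1)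
  have unit: "is_unit h" if h: "h dvd e" "h dvd q" for h
  proof -
    have "h dvd p" using h(1) e by simp
    then have "h dvd d" using h(2) by (simp add: d_def)
    then have "h * h dvd p" using h(1) e mult_dvd_mono by blast
    then show ?thesis using assms squarefreeD[of p h] by (simp add: power2_eq_square)
  qed
  have dq: "d dvd q" by (simp add: d_def)
  have deg: "degree h = 0" if "is_unit h" for h :: "real poly poly"
    using that by (auto simp: is_unit_poly_iff)
  show ?thesis
  proof (rule that[OF e dq])
    show "\<exists>a b c. c \<noteq> 0 \<and> a * d + b * e = [:c:]"
      using p0 e dq unit deg by (intro bezout_poly_poly) (auto intro: dvd_trans)
    show "\<exists>a b c. c \<noteq> 0 \<and> a * e + b * q = [:c:]"
      using p0 e unit deg by (intro bezout_poly_poly) auto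
  qed
qed

section \<open>Polynomials along the branches of a plane curve\<close>

lemma poly_xy_0 [simp]: "poly_xy 0 p = 0"
  by (simp add: poly_xy_def split: prod.splits)

lemma poly_xy_pCons [simp]: "poly_xy (pCons a F) (x, y) = poly a x + y * poly_xy F (x, y)"
  by (simp add: poly_xy_def)

lemma poly_xy_add [simp]: "poly_xy (F + G) p = poly_xy F p + poly_xy G p"
  by (simp add: poly_xy_def split: prod.splits)

lemma poly_xy_diff [simp]: "poly_xy (F - G) p = poly_xy F p - poly_xy G p"
  by (simp add: poly_xy_def split: prod.splits)

lemma poly_xy_mult [simp]: "poly_xy (F * G) p = poly_xy F p * poly_xy G p"
  by (simp add: poly_xy_def split: prod.splits)

lemma poly_xy_conv_poly: "poly_xy F (x, y) = poly (map_poly (\<lambda>a. poly a x) F) y"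
  by (induction F) (simp_all add: map_poly_pCons)

lemma continuous_poly_xy [continuous_intros]:
  assumes "continuous_on S u" "continuous_on S v"
  shows "continuous_on S (\<lambda>t. poly_xy F (u t, v t))"
  by (induction F) (auto intro!: continuous_intros assms)

lemma isCont_poly_xy: "isCont (poly_xy F) p"
proof -
  have "continuous_on UNIV (\<lambda>p. poly_xy F (fst p, snd p))"
    by (intro continuous_intros)
  then show ?thesis by (cases p) (simp add: continuous_on_eq_continuous_at)
qed

lemma box_in_open:
  fixes x0 y0 :: real
  assumes "open U" "(x0, y0) \<in> U"
  shows "\<exists>e>0. \<forall>x y. \<bar>x - x0\<bar> < e \<longrightarrow> \<bar>y - y0\<bar> < e \<longrightarrow> (x, y) \<in> U"
proof -
  obtain A B where AB: "open A" "open B" "x0 \<in> A" "y0 \<in> B" "A \<times> B \<subseteq> U"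
    using assms unfolding open_prod_def by fastforce
  obtain a b where "a > 0" "ball x0 a \<subseteq> A" "b > 0" "ball y0 b \<subseteq> B"
    using AB by (meson openE)
  then have "(x, y) \<in> U" if "\<bar>x - x0\<bar> < min a b" "\<bar>y - y0\<bar> < min a b" for x y
    using that AB(5) by (force simp: dist_real_def abs_minus_commute)
  with \<open>a > 0\<close> \<open>b > 0\<close> show ?thesis by (intro exI[of _ "min a b"]) auto
qed

lemma poly_xy_pos_nearby:
  assumes "s * poly_xy F (x0, y0) > 0"
  shows "\<exists>e>0. \<forall>x y. \<bar>x - x0\<bar> < e \<longrightarrow> \<bar>y - y0\<bar> < e \<longrightarrow> s * poly_xy F (x, y) > 0"
proof -
  have "open ((\<lambda>p. s * poly_xy F p) -` {0<..})"
  proof (rule continuous_open_vimage)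
    show "isCont (\<lambda>p. s * poly_xy F p) p" for p
      by (intro continuous_intros isCont_poly_xy)
  qed auto
  moreover have "(x0, y0) \<in> (\<lambda>p. s * poly_xy F p) -` {0<..}" using assms by simp
  ultimately show ?thesis using box_in_open by fastforce
qed

text \<open>
  The chain rule; \<^term>\<open>map_poly pderiv F\<close> is the partial derivative in \<open>x\<close>.
\<close>

lemma poly_xy_along_curve:
  assumes "(Y has_real_derivative y') (at x)"
  shows "((\<lambda>t. poly_xy F (t, Y t)) has_real_derivative
      poly_xy (map_poly pderiv F) (x, Y x) + poly_xy (pderiv F) (x, Y x) * y') (at x)"
proof (induction F)
  case 0
  then show ?case by simp
next
  case (pCons a F)
  have "((\<lambda>t. poly a t + Y t * poly_xy F (t, Y t)) has_real_derivative
      poly (pderiv a) x + (Y x * (poly_xy (map_poly pderiv F) (x, Y x) + poly_xy (pderiv F) (x, Y x) * y') +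
        y' * poly_xy F (x, Y x))) (at x)"
    by (intro DERIV_add poly_DERIV DERIV_mult' assms pCons.IH)
  then show ?case
    by (simp add: map_poly_pCons pderiv_pCons algebra_simps)
qed

text \<open>
  A Caratheodory form of differentiability in two variables.  It yields the derivative of an implicit
  function whose continuity is already known.
\<close>

lemma poly_xy_slopes:
  "\<exists>A B. isCont A (x, y) \<and> isCont B (x, y) \<and> A (x, y) = poly_xy (map_poly pderiv F) (x, y) \<and>
     B (x, y) = poly_xy (pderiv F) (x, y) \<and>
     (\<forall>s t. poly_xy F (s, t) - poly_xy F (x, y) = (s - x) * A (s, t) + (t - y) * B (s, t))"
proof (induction F)
  case 0
  show ?case by (intro exI[of _ "\<lambda>_. 0"]) auto
next
  case (pCons a F)
  then obtain A B where AB: "isCont A (x, y)" "isCont B (x, y)"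
    "A (x, y) = poly_xy (map_poly pderiv F) (x, y)" "B (x, y) = poly_xy (pderiv F) (x, y)"
    "\<And>s t. poly_xy F (s, t) - poly_xy F (x, y) = (s - x) * A (s, t) + (t - y) * B (s, t)"
    by blast
  obtain g where g: "\<And>s. poly a s - poly a x = g s * (s - x)" "isCont g x" "g x = poly (pderiv a) x"
    using poly_DERIV[of a x] unfolding CARAT_DERIV by blast
  have g': "isCont (\<lambda>p. g (fst p)) (x, y)"
    using g(2) by (intro continuous_at_compose[unfolded o_def, of _ fst g]) (auto intro: continuous_intros)
  show ?case
  proof (intro exI conjI allI)
    show "isCont (\<lambda>p. g (fst p) + y * A p) (x, y)"
      by (intro continuous_intros g' AB)
    show "isCont (\<lambda>p. poly_xy F p + y * B p) (x, y)"
      by (intro continuous_intros isCont_poly_xy AB)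
    fix s t
    show "poly_xy (pCons a F) (s, t) - poly_xy (pCons a F) (x, y) =
      (s - x) * (g (fst (s, t)) + y * A (s, t)) + (t - y) * (poly_xy F (s, t) + y * B (s, t))"
      using AB(5)[of s t] g(1)[of s] by (simp, algebra)
  qed (simp_all add: map_poly_pCons pderiv_pCons AB g)
qed

text \<open>
  The identity of the preceding lemma, taken between two points of the branch, gives the difference
  quotient of \<open>Y\<close> exactly as \<open>- A / B\<close>.
\<close>

lemma branch_has_derivative:
  assumes S: "open S" "x \<in> S" and Y: "continuous_on S Y"
    and G: "\<And>t. t \<in> S \<Longrightarrow> poly_xy G (t, Y t) = 0" and nz: "poly_xy (pderiv G) (x, Y x) \<noteq> 0"
  shows "(Y has_real_derivative
      - (poly_xy (map_poly pderiv G) (x, Y x) / poly_xy (pderiv G) (x, Y x))) (at x)"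
proof -
  obtain A B where AB: "isCont A (x, Y x)" "isCont B (x, Y x)"
    "A (x, Y x) = poly_xy (map_poly pderiv G) (x, Y x)" "B (x, Y x) = poly_xy (pderiv G) (x, Y x)"
    "\<And>s t. poly_xy G (s, t) - poly_xy G (x, Y x) = (s - x) * A (s, t) + (t - Y x) * B (s, t)"
    using poly_xy_slopes[of x "Y x" G] by blast
  have Yx: "isCont Y x" using S Y by (simp add: continuous_on_eq_continuous_at)
  have lim: "((\<lambda>t. (t, Y t)) \<longlongrightarrow> (x, Y x)) (at x)"
    using Yx by (intro tendsto_intros) (simp add: isCont_def)
  have limA: "((\<lambda>t. A (t, Y t)) \<longlongrightarrow> A (x, Y x)) (at x)"
    and limB: "((\<lambda>t. B (t, Y t)) \<longlongrightarrow> B (x, Y x)) (at x)"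
    by (rule isCont_tendsto_compose[OF _ lim], fact)+
  have "((\<lambda>t. - (A (t, Y t) / B (t, Y t))) \<longlongrightarrow> - (A (x, Y x) / B (x, Y x))) (at x)"
    using nz AB(4) by (intro tendsto_intros limA limB) simp
  moreover have "\<forall>\<^sub>F t in at x. - (A (t, Y t) / B (t, Y t)) = (Y t - Y x) / (t - x)"
  proof -
    have "\<forall>\<^sub>F t in at x. B (t, Y t) \<noteq> 0"
      using limB nz AB(4) by (intro tendsto_imp_eventually_ne) auto
    moreover have "\<forall>\<^sub>F t in at x. t \<in> S \<and> t \<noteq> x"
      using S by (auto simp: eventually_at_topological)
    ultimately show ?thesis
    proof eventually_elim
      case (elim t)
      have "(t - x) * A (t, Y t) + (Y t - Y x) * B (t, Y t) = 0"
        using AB(5)[of t "Y t"] G elim S by simp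
      then have "(Y t - Y x) * B (t, Y t) = - A (t, Y t) * (t - x)" by algebra
      with elim show ?case by (simp add: divide_simps)
    qed
  qed
  ultimately have "((\<lambda>t. (Y t - Y x) / (t - x)) \<longlongrightarrow> - (A (x, Y x) / B (x, Y x))) (at x)"
    by (rule Lim_transform_eventually)
  then show ?thesis by (simp add: has_field_derivative_iff AB(3,4))
qed

lemma poly_nonzero_near_0:
  fixes c :: "real poly"
  assumes "c \<noteq> 0"
  shows "\<exists>d>0. \<forall>x. x \<noteq> 0 \<and> \<bar>x\<bar> < d \<longrightarrow> poly c x \<noteq> 0"
proof -
  have "finite ({x. poly c x = 0} - {0})" using assms poly_roots_finite by blast
  then have "open (- ({x. poly c x = 0} - {0}))" by (metis finite_imp_closed open_Compl)
  then obtain d where d: "d > 0" "ball 0 d \<subseteq> - ({x. poly c x = 0} - {0})"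
    by (meson ComplI DiffD2 openE singletonI)
  have "poly c x \<noteq> 0" if "x \<noteq> 0" "\<bar>x\<bar> < d" for x
  proof -
    have "x \<in> ball 0 d" using that by simp
    with d(2) that(1) show ?thesis by blast
  qed
  with d(1) show ?thesis by blast
qed

lemma bezout_no_common_zero:
  assumes "\<exists>a b c. c \<noteq> 0 \<and> a * p + b * q = [:c:]"
  shows "\<exists>d>0. \<forall>x\<in>{0<..<d}. \<forall>y. poly_xy p (x, y) \<noteq> 0 \<or> poly_xy q (x, y) \<noteq> 0"
proof -
  obtain a b c where abc: "c \<noteq> 0" "a * p + b * q = [:c:]" using assms by blast
  obtain d where d: "d > 0" "\<And>x. x \<in> {0<..<d} \<Longrightarrow> poly c x \<noteq> 0"
    using poly_nonzero_near_0[OF abc(1)] by auto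
  have "poly_xy a (x, y) * poly_xy p (x, y) + poly_xy b (x, y) * poly_xy q (x, y) = poly c x" for x y
    using arg_cong[OF abc(2), of "\<lambda>p. poly_xy p (x, y)"] by simp
  with d show ?thesis by (metis add.right_neutral mult_zero_right)
qed

text \<open>
  Write \<open>G = d e\<close> with \<open>d\<close> dividing \<open>q\<close>, where over small \<open>x > 0\<close> neither \<open>d\<close> and \<open>e\<close> nor \<open>e\<close> and \<open>q\<close> have a
  common zero.  The branch is covered by the zeros of \<open>d\<close> and those of \<open>e\<close>, two disjoint closed sets;
  being connected, it lies in one of them.  On the zeros of \<open>d\<close> the polynomial \<open>q\<close> vanishes, on those of \<open>e\<close> it does not.
\<close>

lemma zero_or_nonzero_along_branch:
  assumes sf: "squarefree G" and \<delta>: "0 < \<delta>" and Y: "continuous_on {0<..<\<delta>} Y"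
    and G: "\<And>x. x \<in> {0<..<\<delta>} \<Longrightarrow> poly_xy G (x, Y x) = 0"
  shows "\<exists>\<delta>'. 0 < \<delta>' \<and> \<delta>' \<le> \<delta> \<and>
    ((\<forall>x\<in>{0<..<\<delta>'}. poly_xy q (x, Y x) = 0) \<or> (\<forall>x\<in>{0<..<\<delta>'}. poly_xy q (x, Y x) \<noteq> 0))"
proof -
  obtain d e where de: "G = d * e" "d dvd q"
    and b1: "\<exists>a b c. c \<noteq> 0 \<and> a * d + b * e = [:c:]" and b2: "\<exists>a b c. c \<noteq> 0 \<and> a * e + b * q = [:c:]"
    by (rule squarefree_split_bezout[OF sf, of q])
  obtain \<delta>1 where \<delta>1: "\<delta>1 > 0" "\<And>x y. x \<in> {0<..<\<delta>1} \<Longrightarrow> poly_xy d (x, y) \<noteq> 0 \<or> poly_xy e (x, y) \<noteq> 0"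
    using bezout_no_common_zero[OF b1] by blast
  obtain \<delta>2 where \<delta>2: "\<delta>2 > 0" "\<And>x y. x \<in> {0<..<\<delta>2} \<Longrightarrow> poly_xy e (x, y) \<noteq> 0 \<or> poly_xy q (x, y) \<noteq> 0"
    using bezout_no_common_zero[OF b2] by blast
  define \<delta>' where "\<delta>' = min \<delta> (min \<delta>1 \<delta>2)"
  define I where "I = {0<..<\<delta>'}"
  have Y': "continuous_on I Y"
    by (rule continuous_on_subset[OF Y]) (auto simp: I_def \<delta>'_def)
  have con: "connected I" by (simp add: I_def)
  have cl: "closedin (top_of_set I) {x \<in> I. poly_xy p (x, Y x) = 0}" for p
    by (intro continuous_closedin_preimage_constant continuous_intros Y')
  have cov: "poly_xy d (x, Y x) = 0 \<or> poly_xy e (x, Y x) = 0" if "x \<in> I" for x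
    using G[of x] that by (auto simp: de I_def \<delta>'_def)
  have "(\<forall>x\<in>I. poly_xy d (x, Y x) = 0) \<or> (\<forall>x\<in>I. poly_xy e (x, Y x) = 0)"
  proof (rule ccontr)
    assume n: "\<not> ?thesis"
    define E1 E2 where "E1 = {x \<in> I. poly_xy d (x, Y x) = 0}" and "E2 = {x \<in> I. poly_xy e (x, Y x) = 0}"
    have "closedin (top_of_set I) E1" "closedin (top_of_set I) E2"
      using cl by (simp_all add: E1_def E2_def)
    moreover have "E1 \<union> E2 = I" using cov by (auto simp: E1_def E2_def)
    moreover have "E1 \<inter> E2 = {}" using \<delta>1(2) by (force simp: E1_def E2_def I_def \<delta>'_def)
    moreover have "E1 \<noteq> {}" "E2 \<noteq> {}" using n cov by (auto simp: E1_def E2_def)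
    ultimately show False using con unfolding connected_closedin_eq by blast
  qed
  then have "(\<forall>x\<in>I. poly_xy q (x, Y x) = 0) \<or> (\<forall>x\<in>I. poly_xy q (x, Y x) \<noteq> 0)"
  proof
    assume d0: "\<forall>x\<in>I. poly_xy d (x, Y x) = 0"
    from de(2) obtain k where "q = d * k" by (elim dvdE)
    with d0 show ?thesis by simp
  next
    assume "\<forall>x\<in>I. poly_xy e (x, Y x) = 0"
    then show ?thesis using \<delta>2(2) by (auto simp: I_def \<delta>'_def)
  qed
  moreover have "0 < \<delta>'" "\<delta>' \<le> \<delta>" using \<delta> \<delta>1 \<delta>2 by (auto simp: \<delta>'_def)
  ultimately show ?thesis unfolding I_def by blast
qed

text \<open>
  The mean value theorem between \<open>0\<close> and \<open>x\<close> produces a point where \<open>D\<close> is positive, so \<open>D\<close> has no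
  zero and, by continuity, no negative value.
\<close>

lemma deriv_pos_if_vanishes_at_0:
  fixes \<phi> :: "real \<Rightarrow> real"
  assumes D: "\<And>x. x \<in> {0<..<\<delta>} \<Longrightarrow> (\<phi> has_real_derivative D x) (at x)"
    and cD: "continuous_on {0<..<\<delta>} D"
    and alt: "(\<forall>x\<in>{0<..<\<delta>}. D x = 0) \<or> (\<forall>x\<in>{0<..<\<delta>}. D x \<noteq> 0)"
    and pos: "\<And>x. x \<in> {0<..<\<delta>} \<Longrightarrow> \<phi> x > 0" and lim: "(\<phi> \<longlongrightarrow> 0) (at_right 0)"
    and x: "x \<in> {0<..<\<delta>}"
  shows "D x > 0"
proof (rule ccontr)
  assume neg: "\<not> D x > 0"
  \<comment> \<open>The extension of \<open>\<phi>\<close> by its limit, to which the mean value theorem applies on \<open>[0, x]\<close>.\<close>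
  define \<psi> where "\<psi> t = (if t = 0 then 0 else \<phi> t)" for t
  have d\<psi>: "(\<psi> has_real_derivative D t) (at t)" if "t \<in> {0<..<\<delta>}" for t
    using D[OF that] that by (rule_tac has_field_derivative_transform_within_open[of \<phi> _ _ "{0<..<\<delta>}"]) (auto simp: \<psi>_def)
  have "continuous_on {0..x} \<psi>"
    unfolding continuous_on_eq_continuous_within
  proof
    fix t assume t: "t \<in> {0..x}"
    show "continuous (at t within {0..x}) \<psi>"
    proof (cases "t = 0")
      case True
      have "(\<psi> \<longlongrightarrow> 0) (at_right 0)"
        using lim by (rule Lim_transform_eventually) (auto simp: \<psi>_def eventually_at_filter)
      then have "(\<psi> \<longlongrightarrow> 0) (at 0 within {0..x})"
        using x by (simp add: at_within_Icc_at_right)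
      then show ?thesis using True by (simp add: continuous_within \<psi>_def)
    next
      case False
      then show ?thesis using t x d\<psi>[of t] by (auto intro: continuous_at_imp_continuous_at_within DERIV_isCont)
    qed
  qed
  moreover have "\<psi> differentiable (at t)" if "0 < t" "t < x" for t
    using d\<psi>[of t] that x by (auto simp: real_differentiable_def)
  ultimately obtain l z where z: "0 < z" "z < x" "(\<psi> has_real_derivative l) (at z)" "\<psi> x - \<psi> 0 = (x - 0) * l"
    using MVT[of 0 x \<psi>] x by auto
  have "l = D z" using z d\<psi>[of z] x DERIV_unique by auto
  moreover have "\<psi> x - \<psi> 0 > 0" using pos[OF x] x by (simp add: \<psi>_def)
  ultimately have Dz: "D z > 0" using z x by (auto simp: zero_less_mult_iff)
  have "z \<in> {0<..<\<delta>}" using z x by auto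
  then have nz: "\<forall>x\<in>{0<..<\<delta>}. D x \<noteq> 0" using alt Dz by force
  have "continuous_on {z..x} D"
    by (rule continuous_on_subset[OF cD]) (use z x in auto)
  then obtain w where "z \<le> w" "w \<le> x" "D w = 0"
    using IVT2'[of D x 0 z] neg Dz z by auto
  then show False using nz z x by auto
qed

text \<open>
  With \<open>y' = - G\<^sub>x / G\<^sub>y\<close> the derivative of \<open>p\<close> along the branch is \<open>q / G\<^sub>y\<close> for the polynomial
  \<open>q = p\<^sub>x G\<^sub>y - p\<^sub>y G\<^sub>x\<close>, to which the zero-or-nonzero alternative applies.
\<close>

lemma increasing_along_branch:
  assumes sf: "squarefree G" and \<delta>: "0 < \<delta>" and Y: "continuous_on {0<..<\<delta>} Y"
    and G: "\<And>x. x \<in> {0<..<\<delta>} \<Longrightarrow> poly_xy G (x, Y x) = 0"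
    and nz: "\<And>x. x \<in> {0<..<\<delta>} \<Longrightarrow> poly_xy (pderiv G) (x, Y x) \<noteq> 0"
    and pos: "\<And>x. x \<in> {0<..<\<delta>} \<Longrightarrow> poly_xy p (x, Y x) > 0"
    and lim: "((\<lambda>x. poly_xy p (x, Y x)) \<longlongrightarrow> 0) (at_right 0)"
  shows "\<exists>\<delta>'. 0 < \<delta>' \<and> \<delta>' \<le> \<delta> \<and> (\<forall>x\<in>{0<..<\<delta>'}. \<exists>y'. (Y has_real_derivative y') (at x) \<and>
    poly_xy (map_poly pderiv p) (x, Y x) + poly_xy (pderiv p) (x, Y x) * y' > 0)"
proof -
  define q where "q = map_poly pderiv p * pderiv G - pderiv p * map_poly pderiv G"
  obtain \<delta>' where \<delta>': "0 < \<delta>'" "\<delta>' \<le> \<delta>" and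
    alt: "(\<forall>x\<in>{0<..<\<delta>'}. poly_xy q (x, Y x) = 0) \<or> (\<forall>x\<in>{0<..<\<delta>'}. poly_xy q (x, Y x) \<noteq> 0)"
    using zero_or_nonzero_along_branch[OF sf \<delta> Y G] by blast
  define y' where "y' x = - (poly_xy (map_poly pderiv G) (x, Y x) / poly_xy (pderiv G) (x, Y x))" for x
  define D where "D x = poly_xy (map_poly pderiv p) (x, Y x) + poly_xy (pderiv p) (x, Y x) * y' x" for x
  have Y': "continuous_on {0<..<\<delta>'} Y"
    by (rule continuous_on_subset[OF Y]) (use \<delta>' in auto)
  have dY: "(Y has_real_derivative y' x) (at x)" if "x \<in> {0<..<\<delta>'}" for x
    unfolding y'_def
    by (rule branch_has_derivative[of "{0<..<\<delta>'}"]) (use that \<delta>' Y' G nz in auto)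
  have Dq: "D x = poly_xy q (x, Y x) / poly_xy (pderiv G) (x, Y x)" if "x \<in> {0<..<\<delta>'}" for x
    using nz[of x] that \<delta>' by (simp add: D_def q_def y'_def divide_simps)
  have "D x > 0" if "x \<in> {0<..<\<delta>'}" for x
  proof (rule deriv_pos_if_vanishes_at_0[OF _ _ _ _ lim that])
    show "((\<lambda>x. poly_xy p (x, Y x)) has_real_derivative D x) (at x)" if "x \<in> {0<..<\<delta>'}" for x
      unfolding D_def by (rule poly_xy_along_curve[OF dY[OF that]])
    show "continuous_on {0<..<\<delta>'} D"
      unfolding D_def y'_def using nz \<delta>' by (intro continuous_intros Y') auto
    show "(\<forall>x\<in>{0<..<\<delta>'}. D x = 0) \<or> (\<forall>x\<in>{0<..<\<delta>'}. D x \<noteq> 0)"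
      using alt Dq nz \<delta>' by auto
    show "poly_xy p (x, Y x) > 0" if "x \<in> {0<..<\<delta>'}" for x
      using pos[of x] that \<delta>' by auto
  qed
  then show ?thesis using dY \<delta>' unfolding D_def by blast
qed

section \<open>Simple real roots as continuous functions of a parameter\<close>

text \<open>
  On a box where \<open>G\<^sub>y\<close> has constant sign, \<open>G(x, \<cdot>)\<close> is strictly monotone, and it changes sign between
  \<open>z - e\<close> and \<open>z + e\<close> for \<open>x\<close> near \<open>x0\<close>.
\<close>

lemma isolated_simple_root:
  assumes z: "poly_xy G (x0, z) = 0" and nz: "poly_xy (pderiv G) (x0, z) \<noteq> 0"
  shows "\<exists>e0>0. \<forall>e. 0 < e \<and> e < e0 \<longrightarrow> (\<forall>\<^sub>F x in nhds x0. \<exists>!y. \<bar>y - z\<bar> < e \<and> poly_xy G (x, y) = 0)"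
proof -
  define s where "s = sgn (poly_xy (pderiv G) (x0, z))"
  have s: "s = 1 \<or> s = -1" using nz by (auto simp: s_def sgn_if)
  have "s * poly_xy (pderiv G) (x0, z) > 0"
    using nz by (auto simp: s_def sgn_if)
  from poly_xy_pos_nearby[OF this] obtain e0 where e0: "e0 > 0" and
    pos: "\<And>x y. \<bar>x - x0\<bar> < e0 \<Longrightarrow> \<bar>y - z\<bar> < e0 \<Longrightarrow> s * poly_xy (pderiv G) (x, y) > 0" by blast
  have incr: "s * poly_xy G (x, y1) < s * poly_xy G (x, y2)"
    if "\<bar>x - x0\<bar> < e0" "y1 < y2" "\<bar>y1 - z\<bar> < e0" "\<bar>y2 - z\<bar> < e0" for x y1 y2
  proof (rule DERIV_pos_imp_increasing[OF that(2)])
    fix y assume "y1 \<le> y" "y \<le> y2"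
    then have "s * poly_xy (pderiv G) (x, y) > 0" using that by (intro pos) linarith+
    then show "\<exists>d. ((\<lambda>a. s * poly_xy G (x, a)) has_real_derivative d) (at y) \<and> 0 < d"
      using DERIV_cmult[OF poly_xy_has_deriv_y] by blast
  qed
  have cont: "((\<lambda>x. s * poly_xy G (x, y)) \<longlongrightarrow> s * poly_xy G (x0, y)) (nhds x0)" for y
  proof -
    have "continuous_on UNIV (\<lambda>x. s * poly_xy G (x, y))" by (intro continuous_intros)
    then show ?thesis
      by (metis UNIV_I continuous_on_eq_continuous_at isCont_def open_UNIV tendsto_at_iff_tendsto_nhds)
  qed
  show ?thesis
  proof (intro exI[of _ "e0"] conjI allI impI)
    fix e assume e: "0 < e \<and> e < e0"
    have "s * poly_xy G (x0, z + e) > 0" "s * poly_xy G (x0, z - e) < 0"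
      using incr[of x0 z "z + e"] incr[of x0 "z - e" z] e z by auto
    then have "\<forall>\<^sub>F x in nhds x0. s * poly_xy G (x, z + e) > 0" "\<forall>\<^sub>F x in nhds x0. s * poly_xy G (x, z - e) < 0"
      using order_tendstoD(1)[OF cont] order_tendstoD(2)[OF cont] by blast+
    moreover have "\<forall>\<^sub>F x in nhds x0. \<bar>x - x0\<bar> < e0"
      using e0 unfolding eventually_nhds_metric dist_real_def by (intro exI[of _ e0]) auto
    ultimately show "\<forall>\<^sub>F x in nhds x0. \<exists>!y. \<bar>y - z\<bar> < e \<and> poly_xy G (x, y) = 0"
    proof eventually_elim
      case (elim x)
      have "continuous_on {z - e..z + e} (\<lambda>y. s * poly_xy G (x, y))"
        by (intro continuous_intros)
      then obtain y where y: "z - e \<le> y" "y \<le> z + e" "s * poly_xy G (x, y) = 0"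
        using IVT'[of "\<lambda>y. s * poly_xy G (x, y)" "z - e" 0 "z + e"] elim e by auto
      have "y \<noteq> z - e" "y \<noteq> z + e" using y elim by auto
      show ?case
      proof (rule ex1I[of _ y])
        show "\<bar>y - z\<bar> < e \<and> poly_xy G (x, y) = 0" using y \<open>y \<noteq> z - e\<close> \<open>y \<noteq> z + e\<close> s by auto
        fix y' assume y': "\<bar>y' - z\<bar> < e \<and> poly_xy G (x, y') = 0"
        show "y' = y"
        proof -
          have "\<bar>y - z\<bar> < e0" "\<bar>y' - z\<bar> < e0" using y y' e by linarith+
          then show ?thesis
            using incr[of x y y'] incr[of x y' y] elim y y' by (cases y y' rule: linorder_cases) auto
        qed
      qed
    qed
  qed (use e0 in auto)
qed

text \<open>
  The tube lemma for the open set where \<open>G\<close> does not vanish.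
\<close>

lemma nonzero_on_compact_nearby:
  assumes "compact K" and nz: "\<And>y. y \<in> K \<Longrightarrow> poly_xy G (x0, y) \<noteq> 0"
  shows "\<forall>\<^sub>F x in nhds x0. \<forall>y\<in>K. poly_xy G (x, y) \<noteq> 0"
proof -
  have o: "open (poly_xy G -` (- {0}))"
    by (rule continuous_open_vimage) (auto intro: isCont_poly_xy)
  have "{x0} \<times> K \<subseteq> poly_xy G -` (- {0})" using nz by auto
  from Elementary_Topology.tube_lemma[OF assms(1) o this]
  obtain X where X: "x0 \<in> X" "open X" "X \<times> K \<subseteq> poly_xy G -` (- {0})" by blast
  have "\<forall>y\<in>K. poly_xy G (x, y) \<noteq> 0" if "x \<in> X" for x
  proof
    fix y assume "y \<in> K"
    with that have "(x, y) \<in> X \<times> K" by simp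
    with X(3) have "(x, y) \<in> poly_xy G -` (- {0})" by (rule subsetD)
    then show "poly_xy G (x, y) \<noteq> 0" by simp
  qed
  with X(1,2) show ?thesis unfolding eventually_nhds by blast
qed

text \<open>
  Roots are counted in a window \<open>(-\<eta>, \<eta>)\<close>: none of them enters or leaves it, or escapes to infinity,
  while \<open>x\<close> varies with \<open>G(x, \<plusminus>\<eta>) \<noteq> 0\<close>.
\<close>

definition roots_in :: "real poly poly \<Rightarrow> real \<Rightarrow> real \<Rightarrow> real set" where
  "roots_in G \<eta> x = {y. \<bar>y\<bar> < \<eta> \<and> poly_xy G (x, y) = 0}"

lemma finite_roots_in:
  assumes "poly_xy G (x, y) \<noteq> 0"
  shows "finite (roots_in G \<eta> x)"
proof -
  have "map_poly (\<lambda>a. poly a x) G \<noteq> 0"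
    using assms by (auto simp: poly_xy_conv_poly)
  from poly_roots_finite[OF this] show ?thesis
    by (rule finite_subset[rotated]) (auto simp: roots_in_def poly_xy_conv_poly)
qed

text \<open>
  For small \<open>e\<close> each root \<open>z\<close> of \<open>G(x0, \<cdot>)\<close> continues to a unique root \<open>g z\<close> at distance less than \<open>e\<close>,
  and by compactness there are no further roots in the window.  If the roots are at least \<open>2 e\<close>
  apart then \<open>g\<close> preserves their order, so it maps the sorted list of roots entry by entry.
\<close>

lemma sorted_roots_nearby:
  assumes edge: "poly_xy G (x0, \<eta>) \<noteq> 0" "poly_xy G (x0, - \<eta>) \<noteq> 0"
    and simple: "\<And>y. poly_xy G (x0, y) = 0 \<Longrightarrow> poly_xy (pderiv G) (x0, y) \<noteq> 0"
    and \<epsilon>: "\<epsilon> > 0"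
  shows "\<forall>\<^sub>F x in nhds x0.
    length (sorted_list_of_set (roots_in G \<eta> x)) = length (sorted_list_of_set (roots_in G \<eta> x0)) \<and>
    (\<forall>i<length (sorted_list_of_set (roots_in G \<eta> x0)).
      \<bar>sorted_list_of_set (roots_in G \<eta> x) ! i - sorted_list_of_set (roots_in G \<eta> x0) ! i\<bar> < \<epsilon>)"
proof -
  define Z where "Z = roots_in G \<eta>"
  have fin: "finite (Z x0)" using finite_roots_in[OF edge(1)] by (simp add: Z_def)
  have mem: "\<bar>z\<bar> < \<eta>" "poly_xy G (x0, z) = 0" if "z \<in> Z x0" for z
    using that by (auto simp: Z_def roots_in_def)
  have "\<forall>z\<in>Z x0. \<exists>e0>0. \<forall>e. 0 < e \<and> e < e0 \<longrightarrow>
      (\<forall>\<^sub>F x in nhds x0. \<exists>!y. \<bar>y - z\<bar> < e \<and> poly_xy G (x, y) = 0)"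
    using isolated_simple_root simple mem by blast
  from bchoice[OF this] obtain E where E': "\<forall>z\<in>Z x0. E z > 0 \<and> (\<forall>e. 0 < e \<and> e < E z \<longrightarrow>
      (\<forall>\<^sub>F x in nhds x0. \<exists>!y. \<bar>y - z\<bar> < e \<and> poly_xy G (x, y) = 0))" by blast
  then have E: "\<And>z. z \<in> Z x0 \<Longrightarrow> E z > 0"
    "\<And>z e. z \<in> Z x0 \<Longrightarrow> 0 < e \<Longrightarrow> e < E z \<Longrightarrow>
      \<forall>\<^sub>F x in nhds x0. \<exists>!y. \<bar>y - z\<bar> < e \<and> poly_xy G (x, y) = 0"
    by blast+
  \<comment> \<open>One \<open>e\<close> that isolates every root, keeps the balls inside the window and makes them disjoint.\<close>
  have small: "\<exists>e>0. e < \<epsilon> \<and> (\<forall>z\<in>Z x0. e < E z \<and> e \<le> \<eta> - \<bar>z\<bar> \<and> (\<forall>z'\<in>Z x0. z < z' \<longrightarrow> 2 * e \<le> z' - z))"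
  proof -
    have "\<forall>\<^sub>F e in at_right 0. e < \<epsilon>" "\<forall>\<^sub>F e in at_right 0. e > (0::real)"
      by (rule eventually_at_rightI[of 0 \<epsilon>], use \<epsilon> in auto, rule eventually_at_right_less)
    moreover have "\<forall>\<^sub>F e in at_right 0. \<forall>z\<in>Z x0. e < E z \<and> e \<le> \<eta> - \<bar>z\<bar> \<and> (\<forall>z'\<in>Z x0. z < z' \<longrightarrow> 2 * e \<le> z' - z)"
    proof (intro eventually_ball_finite[OF fin] ballI eventually_conj)
      fix z assume z: "z \<in> Z x0"
      show "\<forall>\<^sub>F e in at_right 0. e < E z" "\<forall>\<^sub>F e in at_right 0. e \<le> \<eta> - \<bar>z\<bar>"
        by (rule eventually_at_rightI[of 0 "E z"], use E(1)[OF z] in auto,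
          rule eventually_at_rightI[of 0 "\<eta> - \<bar>z\<bar>"], use mem(1)[OF z] in auto)
      fix z' assume "z' \<in> Z x0"
      show "\<forall>\<^sub>F e in at_right 0. z < z' \<longrightarrow> 2 * e \<le> z' - z"
      proof (cases "z < z'")
        case True
        then show ?thesis by (intro eventually_at_rightI[of 0 "(z' - z) / 2"]) auto
      qed simp
    qed
    ultimately have "\<forall>\<^sub>F e in at_right (0::real). e > 0 \<and> e < \<epsilon> \<and>
      (\<forall>z\<in>Z x0. e < E z \<and> e \<le> \<eta> - \<bar>z\<bar> \<and> (\<forall>z'\<in>Z x0. z < z' \<longrightarrow> 2 * e \<le> z' - z))"
      by eventually_elim auto
    from eventually_happens'[OF trivial_limit_at_right_real this] show ?thesis by auto
  qed
  then obtain e where e: "e > 0" "e < \<epsilon>" "\<And>z. z \<in> Z x0 \<Longrightarrow> e < E z" "\<And>z. z \<in> Z x0 \<Longrightarrow> e \<le> \<eta> - \<bar>z\<bar>"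
    "\<And>z z'. z \<in> Z x0 \<Longrightarrow> z' \<in> Z x0 \<Longrightarrow> z < z' \<Longrightarrow> 2 * e \<le> z' - z"
    by blast
  \<comment> \<open>The compact remainder of the window, on which \<open>G(x0, \<cdot>)\<close> has no root.\<close>
  define K where "K = {-\<eta>..\<eta>} - (\<Union>z\<in>Z x0. ball z e)"
  have "compact K" unfolding K_def by (intro compact_diff) auto
  moreover have "poly_xy G (x0, y) \<noteq> 0" if "y \<in> K" for y
  proof
    assume "poly_xy G (x0, y) = 0"
    moreover have "y \<noteq> \<eta>" "y \<noteq> - \<eta>" using calculation edge by auto
    ultimately have "y \<in> Z x0" using that by (auto simp: K_def Z_def roots_in_def abs_less_iff)
    then show False using that e(1) by (auto simp: K_def)
  qed
  ultimately have "\<forall>\<^sub>F x in nhds x0. \<forall>y\<in>K. poly_xy G (x, y) \<noteq> 0" by (rule nonzero_on_compact_nearby)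
  moreover have "\<forall>\<^sub>F x in nhds x0. \<forall>z\<in>Z x0. \<exists>!y. \<bar>y - z\<bar> < e \<and> poly_xy G (x, y) = 0"
    by (intro eventually_ball_finite[OF fin] ballI E(2) e)
  moreover have "\<forall>\<^sub>F x in nhds x0. \<forall>y\<in>{\<eta>}. poly_xy G (x, y) \<noteq> 0"
    by (rule nonzero_on_compact_nearby) (use edge in auto)
  ultimately have "\<forall>\<^sub>F x in nhds x0. \<exists>g. sorted_list_of_set (Z x) = map g (sorted_list_of_set (Z x0)) \<and>
      (\<forall>z\<in>Z x0. \<bar>g z - z\<bar> < e)"
  proof eventually_elim
    case (elim x)
    define g where "g z = (THE y. \<bar>y - z\<bar> < e \<and> poly_xy G (x, y) = 0)" for z
    have g: "\<bar>g z - z\<bar> < e" "poly_xy G (x, g z) = 0" if "z \<in> Z x0" for z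
      using theI'[OF bspec[OF elim(2) that]] unfolding g_def by (rule conjunct1 conjunct2)+
    have guniq: "y = g z" if "z \<in> Z x0" "\<bar>y - z\<bar> < e" "poly_xy G (x, y) = 0" for y z
      using the1_equality[OF bspec[OF elim(2) that(1)] conjI[OF that(2,3)]] unfolding g_def by (rule sym)
    have gmono: "g z < g z'" if "z \<in> Z x0" "z' \<in> Z x0" "z < z'" for z z'
      using g(1)[OF that(1)] g(1)[OF that(2)] e(5)[OF that] by linarith
    have "Z x = g ` Z x0"
    proof (intro equalityI subsetI)
      fix y assume y: "y \<in> Z x"
      then have "y \<notin> K" using elim(1) by (auto simp: Z_def roots_in_def)
      then obtain z where "z \<in> Z x0" "y \<in> ball z e"
        using y by (auto simp: K_def Z_def roots_in_def)
      then show "y \<in> g ` Z x0"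
        using guniq[of z y] y by (auto simp: Z_def roots_in_def dist_real_def abs_minus_commute)
    next
      fix y assume "y \<in> g ` Z x0"
      then obtain z where z: "z \<in> Z x0" "y = g z" by blast
      have "\<bar>y\<bar> < \<eta>" using g(1)[OF z(1)] e(4)[OF z(1)] z(2) by linarith
      then show "y \<in> Z x" using g(2) z by (auto simp: Z_def roots_in_def)
    qed
    moreover have "sorted_wrt (<) (map g (sorted_list_of_set (Z x0)))"
      unfolding sorted_wrt_map
      by (rule sorted_wrt_mono_rel[OF _ strict_sorted_list_of_set]) (use fin gmono in auto)
    ultimately have "sorted_list_of_set (Z x) = map g (sorted_list_of_set (Z x0))"
      using fin sorted_list_of_set.idem_if_sorted_distinct[of "map g (sorted_list_of_set (Z x0))"]
      by (simp add: strict_sorted_iff)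
    then show ?case using g(1) by blast
  qed
  then show ?thesis
    unfolding Z_def[symmetric]
  proof eventually_elim
    case (elim x)
    then obtain g where g: "sorted_list_of_set (Z x) = map g (sorted_list_of_set (Z x0))"
      "\<And>z. z \<in> Z x0 \<Longrightarrow> \<bar>g z - z\<bar> < e" by blast
    have "\<bar>g (sorted_list_of_set (Z x0) ! i) - sorted_list_of_set (Z x0) ! i\<bar> < e"
      if "i < length (sorted_list_of_set (Z x0))" for i
      using g(2) fin nth_mem[OF that] by simp
    then have "\<bar>sorted_list_of_set (Z x) ! i - sorted_list_of_set (Z x0) ! i\<bar> < \<epsilon>"
      if "i < length (sorted_list_of_set (Z x0))" for i
      using that e(2) unfolding g(1) nth_map[OF that] by (meson order_less_trans)
    then show ?case using g(1) by simp
  qed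
qed

text \<open>
  The number of roots in the window is locally constant, hence constant on the interval, and \<open>Y i x\<close> can
  be defined as the \<open>i\<close>-th smallest root.
\<close>

lemma real_root_branches:
  assumes edge: "\<And>x. x \<in> {0<..<\<delta>} \<Longrightarrow> poly_xy G (x, \<eta>) \<noteq> 0 \<and> poly_xy G (x, - \<eta>) \<noteq> 0"
    and simple: "\<And>x y. x \<in> {0<..<\<delta>} \<Longrightarrow> poly_xy G (x, y) = 0 \<Longrightarrow> poly_xy (pderiv G) (x, y) \<noteq> 0"
  shows "\<exists>(n :: nat) Y.
    (\<forall>x\<in>{0<..<\<delta>}. {y. \<bar>y\<bar> < \<eta> \<and> poly_xy G (x, y) = 0} = (\<lambda>i. Y i x) ` {1..n}) \<and>
    (\<forall>x\<in>{0<..<\<delta>}. \<forall>i\<in>{1..n}. \<forall>j\<in>{1..n}. i < j \<longrightarrow> Y i x < Y j x) \<and>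
    (\<forall>i\<in>{1..n}. continuous_on {0<..<\<delta>} (Y i))"
proof -
  define L where "L x = sorted_list_of_set (roots_in G \<eta> x)" for x
  define n where "n = length (L (\<delta> / 2))"
  define Y where "Y i x = L x ! (i - 1)" for i x
  have near: "\<forall>\<^sub>F x in nhds x0. length (L x) = length (L x0) \<and> (\<forall>i<length (L x0). \<bar>L x ! i - L x0 ! i\<bar> < \<epsilon>)"
    if "x0 \<in> {0<..<\<delta>}" "\<epsilon> > 0" for x0 \<epsilon>
    unfolding L_def by (rule sorted_roots_nearby) (use edge simple that in auto)
  have len: "length (L x) = n" if x: "x \<in> {0<..<\<delta>}" for x
    unfolding n_def
  proof (rule connected_local_const[where f = "\<lambda>x. length (L x)" and A = "{0<..<\<delta>}"])
    show "\<forall>a\<in>{0<..<\<delta>}. \<forall>\<^sub>F b in at a within {0<..<\<delta>}. length (L a) = length (L b)"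
    proof
      fix a assume a: "a \<in> {0<..<\<delta>}"
      have "\<forall>\<^sub>F b in nhds a. length (L a) = length (L b)"
        using near[OF a zero_less_one] by eventually_elim auto
      then show "\<forall>\<^sub>F b in at a within {0<..<\<delta>}. length (L a) = length (L b)"
        unfolding at_within_def by (rule filter_leD[rotated]) simp
    qed
  qed (use x in auto)
  show ?thesis
  proof (intro exI conjI ballI impI)
    fix x assume x: "x \<in> {0<..<\<delta>}"
    have fin: "finite (roots_in G \<eta> x)" using finite_roots_in edge[OF x] by blast
    have "(\<lambda>i. Y i x) ` {1..n} = (\<lambda>i. L x ! i) ` {..<n}"
    proof -
      have "{1..n} = Suc ` {..<n}" by (simp add: lessThan_atLeast0 image_Suc_atLeastLessThan atLeastLessThanSuc_atLeastAtMost)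
      then show ?thesis by (simp add: Y_def image_image)
    qed
    also have "\<dots> = set (L x)" using len[OF x] by (auto simp: set_conv_nth)
    also have "\<dots> = {y. \<bar>y\<bar> < \<eta> \<and> poly_xy G (x, y) = 0}"
      using fin by (simp add: L_def roots_in_def)
    finally show "{y. \<bar>y\<bar> < \<eta> \<and> poly_xy G (x, y) = 0} = (\<lambda>i. Y i x) ` {1..n}" by simp
    fix i j assume "i \<in> {1..n}" "j \<in> {1..n}" "i < j"
    then show "Y i x < Y j x"
      using len[OF x] sorted_wrt_nth_less[OF strict_sorted_list_of_set, of "i - 1" "j - 1" "roots_in G \<eta> x"]
      by (auto simp: Y_def L_def)
  next
    fix i assume i: "i \<in> {1..n}"
    show "continuous_on {0<..<\<delta>} (Y i)"
      unfolding continuous_on_def tendsto_iff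
    proof (intro ballI allI impI)
      fix a \<epsilon> :: real assume a: "a \<in> {0<..<\<delta>}" and \<epsilon>: "0 < \<epsilon>"
      have "\<forall>\<^sub>F b in nhds a. dist (Y i b) (Y i a) < \<epsilon>"
        using near[OF a \<epsilon>] by eventually_elim (use i len[OF a] in \<open>auto simp: Y_def dist_real_def\<close>)
      then show "\<forall>\<^sub>F b in at a within {0<..<\<delta>}. dist (Y i b) (Y i a) < \<epsilon>"
        unfolding at_within_def by (rule filter_leD[rotated]) simp
    qed
  qed
qed

section \<open>The right branches of the polar curve\<close>

text \<open>
  A box \<open>(0, \<delta>) \<times> (-\<eta>, \<eta>)\<close> in which the polar curve has the normal form on which the geometry rests.
\<close>

locale right_branches =
  fixes F :: "real poly poly" and \<delta> \<eta> :: real and n :: nat and Y :: "nat \<Rightarrow> real \<Rightarrow> real"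
  assumes \<delta>: "0 < \<delta>" and \<eta>: "0 < \<eta>"
    and roots: "\<And>x y. x \<in> {0<..<\<delta>} \<Longrightarrow> \<bar>y\<bar> < \<eta> \<Longrightarrow>
      poly_xy (pderiv F) (x, y) = 0 \<longleftrightarrow> y \<in> (\<lambda>i. Y i x) ` {1..n}"
    and bound: "\<And>x i. x \<in> {0<..<\<delta>} \<Longrightarrow> i \<in> {1..n} \<Longrightarrow> \<bar>Y i x\<bar> < \<eta>"
    and ordered: "\<And>x i j. x \<in> {0<..<\<delta>} \<Longrightarrow> i \<in> {1..n} \<Longrightarrow> j \<in> {1..n} \<Longrightarrow> i < j \<Longrightarrow> Y i x < Y j x"
    and cont: "\<And>i. i \<in> {1..n} \<Longrightarrow> continuous_on {0<..<\<delta>} (Y i)"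
    and lim: "\<And>i. i \<in> {1..n} \<Longrightarrow> (Y i \<longlongrightarrow> 0) (at_right 0)"
    and simple: "\<And>x i. x \<in> {0<..<\<delta>} \<Longrightarrow> i \<in> {1..n} \<Longrightarrow> poly_xy (pderiv (pderiv F)) (x, Y i x) \<noteq> 0"
    and radius_mono: "\<And>x x' i. x \<in> {0<..<\<delta>} \<Longrightarrow> x' \<in> {0<..<\<delta>} \<Longrightarrow> i \<in> {1..n} \<Longrightarrow> x < x' \<Longrightarrow>
      norm (x, Y i x) < norm (x', Y i x')"
    and height_mono: "\<And>x x' i. x \<in> {0<..<\<delta>} \<Longrightarrow> x' \<in> {0<..<\<delta>} \<Longrightarrow> i \<in> {1..n} \<Longrightarrow> x < x' \<Longrightarrow>
      poly_xy F (x, Y i x) < poly_xy F (x', Y i x')"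
    and deriv_x_pos: "\<And>x i. x \<in> {0<..<\<delta>} \<Longrightarrow> i \<in> {1..n} \<Longrightarrow> poly_xy (map_poly pderiv F) (x, Y i x) > 0"
    and heights_distinct: "\<And>x i j. x \<in> {0<..<\<delta>} \<Longrightarrow> i \<in> {1..n} \<Longrightarrow> j \<in> {1..n} \<Longrightarrow> i \<noteq> j \<Longrightarrow>
      poly_xy F (x, Y i x) \<noteq> poly_xy F (x, Y j x)"
    and zero_at_origin: "poly_xy F (0, 0) = 0"
    and pos: "\<And>x y. \<bar>x\<bar> < \<delta> \<Longrightarrow> \<bar>y\<bar> < \<eta> \<Longrightarrow> (x, y) \<noteq> (0, 0) \<Longrightarrow> poly_xy F (x, y) > 0"
    and axis: "\<And>y. y \<noteq> 0 \<Longrightarrow> \<bar>y\<bar> < \<eta> \<Longrightarrow> poly_xy (pderiv F) (0, y) \<noteq> 0"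

text \<open>
  If \<open>f\<^sub>y\<close> vanished on the whole axis \<open>x = 0\<close>, this line would belong to the polar curve and \<open>f\<close> would be
  constant on it, against the injectivity of the polar map.
\<close>

lemma pderiv_nonzero_on_axis:
  assumes inj: "inj_on (polar_map (poly_xy F)) (polar_curve (poly_xy F))"
  shows "\<exists>\<eta>>0. \<forall>y. y \<noteq> 0 \<and> \<bar>y\<bar> < \<eta> \<longrightarrow> poly_xy (pderiv F) (0, y) \<noteq> 0"
proof -
  define g where "g = map_poly (\<lambda>a. poly a 0) (pderiv F)"
  have g: "poly g y = poly_xy (pderiv F) (0, y)" for y
    by (simp add: g_def poly_xy_conv_poly)
  have "g \<noteq> 0"
  proof
    assume "g = 0"
    then have z: "poly_xy (pderiv F) (0, y) = 0" for y using g[of y] by simp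
    have "((\<lambda>t. poly_xy F (0, t)) has_real_derivative 0) (at y)" for y
      using poly_xy_has_deriv_y[of F 0 y] z by simp
    then have "poly_xy F (0, 0) = poly_xy F (0, 1)"
      using DERIV_isconst_all by blast
    then have "polar_map (poly_xy F) (0, 0) = polar_map (poly_xy F) (0, 1)"
      by (simp add: polar_map_def)
    moreover have "(0, 0) \<in> polar_curve (poly_xy F)" "(0, 1) \<in> polar_curve (poly_xy F)"
      using z by (simp_all add: polar_curve_poly_xy)
    ultimately show False using inj_onD[OF inj] by fastforce
  qed
  from poly_nonzero_near_0[OF this] show ?thesis by (simp add: g)
qed

lemma positive_box:
  assumes min: "strict_local_min (poly_xy F) (0, 0)" and F0: "poly_xy F (0, 0) = 0"
  shows "\<exists>r>0. \<forall>x y. \<bar>x\<bar> < r \<and> \<bar>y\<bar> < r \<and> (x, y) \<noteq> (0, 0) \<longrightarrow> poly_xy F (x, y) > 0"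
proof -
  obtain d where d: "d > 0" "\<And>p. p \<noteq> (0, 0) \<Longrightarrow> dist p (0, 0) < d \<Longrightarrow> poly_xy F p > 0"
    using min F0 unfolding strict_local_min_def eventually_at by auto
  have "poly_xy F (x, y) > 0" if "\<bar>x\<bar> < d / 2" "\<bar>y\<bar> < d / 2" "(x, y) \<noteq> (0, 0)" for x y
    using that norm_Pair_le[of x y] by (intro d(2)) (auto simp: dist_norm)
  with d(1) show ?thesis by (intro exI[of _ "d / 2"]) auto
qed

text \<open>
  Since \<open>G(0, y) \<noteq> 0\<close> for \<open>e \<le> \<bar>y\<bar> \<le> \<eta>\<close>, compactness excludes roots in that range for small \<open>x\<close>.
\<close>

lemma branch_tendsto_0:
  assumes \<delta>: "0 < \<delta>" and Y: "\<And>x. x \<in> {0<..<\<delta>} \<Longrightarrow> \<bar>Y x\<bar> < \<eta> \<and> poly_xy G (x, Y x) = 0"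
    and axis: "\<And>y. y \<noteq> 0 \<Longrightarrow> \<bar>y\<bar> \<le> \<eta> \<Longrightarrow> poly_xy G (0, y) \<noteq> 0"
  shows "(Y \<longlongrightarrow> 0) (at_right 0)"
  unfolding tendsto_iff
proof (intro allI impI)
  fix e :: real assume e: "0 < e"
  have "\<forall>\<^sub>F x in nhds 0. \<forall>y\<in>{-\<eta>..-e} \<union> {e..\<eta>}. poly_xy G (x, y) \<noteq> 0"
    by (intro nonzero_on_compact_nearby compact_Un axis) (use e in auto)
  then have "\<forall>\<^sub>F x in at_right 0. \<forall>y\<in>{-\<eta>..-e} \<union> {e..\<eta>}. poly_xy G (x, y) \<noteq> 0"
    unfolding at_within_def by (rule filter_leD[rotated]) simp
  moreover have "\<forall>\<^sub>F x in at_right 0. x \<in> {0<..<\<delta>}"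
    by (rule eventually_at_rightI[of 0 \<delta>]) (use \<delta> in auto)
  ultimately show "\<forall>\<^sub>F x in at_right 0. dist (Y x) 0 < e"
  proof eventually_elim
    case (elim x)
    have "Y x \<notin> {-\<eta>..-e} \<union> {e..\<eta>}" using elim(1) Y[OF elim(2)] by blast
    with Y[OF elim(2)] show ?case by (auto simp: abs_if split: if_splits)
  qed
qed

lemma at_right_0_Ioo:
  assumes "0 < d" and "\<And>x. x \<in> {0<..<d} \<Longrightarrow> P x"
  shows "\<forall>\<^sub>F d' in at_right (0::real). \<forall>x\<in>{0<..<d'}. P x"
  by (rule eventually_at_rightI[of 0 d]) (use assms in auto)

text \<open>
  The window \<open>\<eta>\<close> is chosen first, so small that \<open>f\<close> is positive and the origin is the only zero of \<open>f\<^sub>y\<close>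
  on the axis in the window; then \<open>\<delta>\<close> is shrunk finitely often, for the edges of the box, the simplicity of the
  roots, and the monotonicity of height and radius along each of the finitely many branches.
\<close>

lemma exists_right_branches:
  assumes F0: "poly_xy F (0, 0) = 0" and min: "strict_local_min (poly_xy F) (0, 0)"
    and sf: "squarefree (pderiv F)" and inj: "inj_on (polar_map (poly_xy F)) (polar_curve (poly_xy F))"
  shows "\<exists>\<delta> \<eta> n Y. right_branches F \<delta> \<eta> n Y"
proof -
  obtain \<eta>0 where \<eta>0: "\<eta>0 > 0" "\<And>y. y \<noteq> 0 \<Longrightarrow> \<bar>y\<bar> < \<eta>0 \<Longrightarrow> poly_xy (pderiv F) (0, y) \<noteq> 0"
    using pderiv_nonzero_on_axis[OF inj] by blast
  obtain r where r: "r > 0" "\<And>x y. \<bar>x\<bar> < r \<Longrightarrow> \<bar>y\<bar> < r \<Longrightarrow> (x, y) \<noteq> (0, 0) \<Longrightarrow> poly_xy F (x, y) > 0"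
    using positive_box[OF min F0] by blast
  define \<eta> where "\<eta> = min (\<eta>0 / 2) r"
  have \<eta>: "\<eta> > 0" "\<eta> < \<eta>0" "\<eta> \<le> r" using \<eta>0 r by (auto simp: \<eta>_def)
  have axis: "poly_xy (pderiv F) (0, y) \<noteq> 0" if "y \<noteq> 0" "\<bar>y\<bar> \<le> \<eta>" for y
    using \<eta>0(2) that \<eta> by auto
  have "\<forall>\<^sub>F x in nhds 0. \<forall>y\<in>{\<eta>, -\<eta>}. poly_xy (pderiv F) (x, y) \<noteq> 0"
    by (intro nonzero_on_compact_nearby axis) (use \<eta> in auto)
  then obtain \<delta>1 where \<delta>1: "\<delta>1 > 0"
    "\<And>x. \<bar>x\<bar> < \<delta>1 \<Longrightarrow> poly_xy (pderiv F) (x, \<eta>) \<noteq> 0 \<and> poly_xy (pderiv F) (x, - \<eta>) \<noteq> 0"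
    unfolding eventually_nhds_metric by auto
  obtain \<delta>2 where \<delta>2: "\<delta>2 > 0"
    "\<And>x y. x \<in> {0<..<\<delta>2} \<Longrightarrow> poly_xy (pderiv F) (x, y) \<noteq> 0 \<or> poly_xy (pderiv (pderiv F)) (x, y) \<noteq> 0"
    using bezout_no_common_zero[OF squarefree_bezout_pderiv[OF sf]] by blast
  define \<delta>3 where "\<delta>3 = min r (min \<delta>1 \<delta>2)"
  have \<delta>3: "\<delta>3 > 0" using r \<delta>1 \<delta>2 by (simp add: \<delta>3_def)
  have edge: "poly_xy (pderiv F) (x, \<eta>) \<noteq> 0 \<and> poly_xy (pderiv F) (x, - \<eta>) \<noteq> 0"
    if "x \<in> {0<..<\<delta>3}" for x
    using that \<delta>1(2)[of x] by (auto simp: \<delta>3_def)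
  have simple: "poly_xy (pderiv (pderiv F)) (x, y) \<noteq> 0"
    if "x \<in> {0<..<\<delta>3}" "poly_xy (pderiv F) (x, y) = 0" for x y
    using that \<delta>2(2)[of x y] by (auto simp: \<delta>3_def)
  have "\<exists>(n :: nat) Y.
    (\<forall>x\<in>{0<..<\<delta>3}. {y. \<bar>y\<bar> < \<eta> \<and> poly_xy (pderiv F) (x, y) = 0} = (\<lambda>i. Y i x) ` {1..n}) \<and>
    (\<forall>x\<in>{0<..<\<delta>3}. \<forall>i\<in>{1..n}. \<forall>j\<in>{1..n}. i < j \<longrightarrow> Y i x < Y j x) \<and>
    (\<forall>i\<in>{1..n}. continuous_on {0<..<\<delta>3} (Y i))"
    by (rule real_root_branches, erule edge, erule (1) simple)
  then obtain n :: nat and Y where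
    R: "\<forall>x\<in>{0<..<\<delta>3}. {y. \<bar>y\<bar> < \<eta> \<and> poly_xy (pderiv F) (x, y) = 0} = (\<lambda>i. Y i x) ` {1..n}"
    and O: "\<forall>x\<in>{0<..<\<delta>3}. \<forall>i\<in>{1..n}. \<forall>j\<in>{1..n}. i < j \<longrightarrow> Y i x < Y j x"
    and C: "\<forall>i\<in>{1..n}. continuous_on {0<..<\<delta>3} (Y i)"
    by blast
  note R = bspec[OF R] and O = O[rule_format] and C = bspec[OF C]
  have B: "\<bar>Y i x\<bar> < \<eta> \<and> poly_xy (pderiv F) (x, Y i x) = 0" if "x \<in> {0<..<\<delta>3}" "i \<in> {1..n}" for x i
    using R[OF that(1)] that(2) by blast
  have L: "(Y i \<longlongrightarrow> 0) (at_right 0)" if "i \<in> {1..n}" for i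
    by (rule branch_tendsto_0[OF \<delta>3 B axis]) (use that in auto)
  have Lim: "((\<lambda>x. poly_xy p (x, Y i x)) \<longlongrightarrow> poly_xy p (0, 0)) (at_right 0)" if "i \<in> {1..n}" for i p
    by (rule isCont_tendsto_compose[OF isCont_poly_xy]) (intro tendsto_intros L that)
  have incr: "\<forall>\<^sub>F d in at_right 0. \<forall>x\<in>{0<..<d}. \<exists>y'. (Y i has_real_derivative y') (at x) \<and>
      poly_xy (map_poly pderiv p) (x, Y i x) + poly_xy (pderiv p) (x, Y i x) * y' > 0"
    if i: "i \<in> {1..n}" and p0: "poly_xy p (0, 0) = 0"
      and p: "\<And>x y. x \<in> {0<..<\<delta>3} \<Longrightarrow> \<bar>y\<bar> < \<eta> \<Longrightarrow> poly_xy p (x, y) > 0" for i p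
  proof -
    have "\<exists>\<delta>'. 0 < \<delta>' \<and> \<delta>' \<le> \<delta>3 \<and> (\<forall>x\<in>{0<..<\<delta>'}. \<exists>y'. (Y i has_real_derivative y') (at x) \<and>
      poly_xy (map_poly pderiv p) (x, Y i x) + poly_xy (pderiv p) (x, Y i x) * y' > 0)"
    proof (rule increasing_along_branch[OF sf \<delta>3 C[OF i]])
      show "((\<lambda>x. poly_xy p (x, Y i x)) \<longlongrightarrow> 0) (at_right 0)" using Lim[OF i, of p] by (simp add: p0)
      fix x assume x: "x \<in> {0<..<\<delta>3}"
      show "poly_xy (pderiv F) (x, Y i x) = 0" using B[OF x i] by blast
      then show "poly_xy (pderiv (pderiv F)) (x, Y i x) \<noteq> 0" by (rule simple[OF x])
      show "poly_xy p (x, Y i x) > 0" using B[OF x i] p[OF x] by blast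
    qed
    then obtain \<delta>' where "0 < \<delta>'" "\<forall>x\<in>{0<..<\<delta>'}. \<exists>y'. (Y i has_real_derivative y') (at x) \<and>
      poly_xy (map_poly pderiv p) (x, Y i x) + poly_xy (pderiv p) (x, Y i x) * y' > 0" by blast
    then show ?thesis by (intro at_right_0_Ioo) blast+
  qed
  \<comment> \<open>The squared distance to the origin as a polynomial.\<close>
  define q :: "real poly poly" where "q = [:[:0, 0, 1:], 0, 1:]"
  have q: "poly_xy q (x, y) = x\<^sup>2 + y\<^sup>2" for x y
    by (simp add: q_def power2_eq_square)
  have "\<forall>\<^sub>F d in at_right 0. \<forall>i\<in>{1..n}. \<forall>x\<in>{0<..<d}. \<exists>y'. (Y i has_real_derivative y') (at x) \<and>
      poly_xy (map_poly pderiv F) (x, Y i x) + poly_xy (pderiv F) (x, Y i x) * y' > 0"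
    by (intro eventually_ball_finite ballI incr F0 r(2)) (use \<eta> in \<open>auto simp: \<delta>3_def\<close>)
  moreover have "\<forall>\<^sub>F d in at_right 0. \<forall>i\<in>{1..n}. \<forall>x\<in>{0<..<d}. \<exists>y'. (Y i has_real_derivative y') (at x) \<and>
      poly_xy (map_poly pderiv q) (x, Y i x) + poly_xy (pderiv q) (x, Y i x) * y' > 0"
    by (intro eventually_ball_finite ballI incr) (auto simp: q intro: add_pos_nonneg)
  moreover have "\<forall>\<^sub>F d in at_right 0. d \<in> {0<..<\<delta>3}"
    by (rule eventually_at_rightI[of 0 \<delta>3]) (use \<delta>3 in auto)
  ultimately have "\<forall>\<^sub>F \<delta> in at_right 0. right_branches F \<delta> \<eta> n Y"
  proof eventually_elim
    case (elim \<delta>)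
    have sub: "x \<in> {0<..<\<delta>3}" if "x \<in> {0<..<\<delta>}" for x using that elim(3) by auto
    have mono: "poly_xy p (x, Y i x) < poly_xy p (x', Y i x')"
      if i: "i \<in> {1..n}" and x: "x \<in> {0<..<\<delta>}" "x' \<in> {0<..<\<delta>}" "x < x'"
      and p: "\<forall>x\<in>{0<..<\<delta>}. \<exists>y'. (Y i has_real_derivative y') (at x) \<and>
        poly_xy (map_poly pderiv p) (x, Y i x) + poly_xy (pderiv p) (x, Y i x) * y' > 0" for i x x' p
    proof (rule DERIV_pos_imp_increasing[OF x(3)])
      fix t assume "x \<le> t" "t \<le> x'"
      then have "t \<in> {0<..<\<delta>}" using x by auto
      with p show "\<exists>d. ((\<lambda>x. poly_xy p (x, Y i x)) has_real_derivative d) (at t) \<and> 0 < d"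
        using poly_xy_along_curve by blast
    qed
    show ?case
    proof
      show "0 < \<delta>" "0 < \<eta>" using elim \<eta> by auto
      fix x y assume x: "x \<in> {0<..<\<delta>}" and y: "\<bar>y\<bar> < \<eta>"
      show "poly_xy (pderiv F) (x, y) = 0 \<longleftrightarrow> y \<in> (\<lambda>i. Y i x) ` {1..n}"
        unfolding R[OF sub[OF x], symmetric] using y by simp
    next
      fix x i assume x: "x \<in> {0<..<\<delta>}" and i: "i \<in> {1..n}"
      show "\<bar>Y i x\<bar> < \<eta>" "poly_xy (pderiv (pderiv F)) (x, Y i x) \<noteq> 0"
        using B[OF sub[OF x] i] simple sub[OF x] by blast+
      show "poly_xy (map_poly pderiv F) (x, Y i x) > 0"
        using bspec[OF bspec[OF elim(1) i] x] B[OF sub[OF x] i] by simp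
      fix j assume j: "j \<in> {1..n}"
      show "Y i x < Y j x" if "i < j" using O sub x i j that by blast
      show "poly_xy F (x, Y i x) \<noteq> poly_xy F (x, Y j x)" if "i \<noteq> j"
      proof
        assume "poly_xy F (x, Y i x) = poly_xy F (x, Y j x)"
        then have "polar_map (poly_xy F) (x, Y i x) = polar_map (poly_xy F) (x, Y j x)"
          by (simp add: polar_map_def)
        moreover have "(x, Y i x) \<in> polar_curve (poly_xy F)" "(x, Y j x) \<in> polar_curve (poly_xy F)"
          using B sub x i j by (simp_all add: polar_curve_poly_xy)
        ultimately have "Y i x = Y j x" using inj_onD[OF inj] by fastforce
        moreover have "Y i x < Y j x \<or> Y j x < Y i x"
          using O sub x i j \<open>i \<noteq> j\<close> by (meson linorder_neqE_nat)
        ultimately show False by simp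
      qed
    next
      fix i assume i: "i \<in> {1..n}"
      show "continuous_on {0<..<\<delta>} (Y i)"
        by (rule continuous_on_subset[OF C[OF i]]) (use sub in auto)
      show "(Y i \<longlongrightarrow> 0) (at_right 0)" by (rule L[OF i])
      fix x x' assume x: "x \<in> {0<..<\<delta>}" "x' \<in> {0<..<\<delta>}" "x < x'"
      show "poly_xy F (x, Y i x) < poly_xy F (x', Y i x')"
        using mono[OF i x] elim(1) i by blast
      have "poly_xy q (x, Y i x) < poly_xy q (x', Y i x')"
        using mono[OF i x] elim(2) i by blast
      then show "norm (x, Y i x) < norm (x', Y i x')"
        by (simp add: q norm_Pair)
    next
      fix x y assume "\<bar>x\<bar> < \<delta>" "\<bar>y\<bar> < \<eta>" "(x, y) \<noteq> (0, 0 :: real)"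
      then show "poly_xy F (x, y) > 0" using elim(3) \<eta> by (intro r(2)) (auto simp: \<delta>3_def)
    next
      fix y assume "y \<noteq> 0" "\<bar>y\<bar> < \<eta>"
      then show "poly_xy (pderiv F) (0, y) \<noteq> 0" by (intro axis) auto
    qed (fact F0)
  qed
  from eventually_happens'[OF trivial_limit_at_right_real this] show ?thesis by blast
qed

section \<open>Half-branches as components and their counterclockwise order\<close>

lemma attained_near_0:
  fixes \<phi> :: "real \<Rightarrow> real"
  assumes cont: "continuous_on {0<..<\<delta>} \<phi>" and lim: "(\<phi> \<longlongrightarrow> 0) (at_right 0)"
    and x1: "x1 \<in> {0<..<\<delta>}" and t: "0 < t" "t < \<phi> x1"
  shows "\<exists>x\<in>{0<..<x1}. \<phi> x = t"
proof -
  have "\<forall>\<^sub>F x in at_right 0. \<phi> x < t" using order_tendstoD(2)[OF lim t(1)] .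
  moreover have "\<forall>\<^sub>F x in at_right 0. x \<in> {0<..<x1}"
    by (rule eventually_at_rightI[of 0 x1]) (use x1 in auto)
  ultimately have "\<forall>\<^sub>F x in at_right 0. \<phi> x < t \<and> x \<in> {0<..<x1}" by (rule eventually_conj)
  from eventually_happens'[OF trivial_limit_at_right_real this]
  obtain x0 where x0: "\<phi> x0 < t" "x0 \<in> {0<..<x1}" by blast
  have "continuous_on {x0..x1} \<phi>"
    by (rule continuous_on_subset[OF cont]) (use x0 x1 in auto)
  then obtain x where x: "x0 \<le> x" "x \<le> x1" "\<phi> x = t"
    using IVT'[of \<phi> x0 t x1] x0 t by auto
  moreover have "x \<noteq> x1" using x t by auto
  ultimately show ?thesis using x0 by (intro bexI[of _ x]) auto
qed

lemma mem_ball_origin: "p \<in> ball (0, 0) r \<longleftrightarrow> norm p < r"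
  for p :: "real \<times> real"
  by (simp add: dist_norm flip: zero_prod_def)

lemma mem_sphere_origin: "p \<in> sphere (0, 0) r \<longleftrightarrow> norm p = r"
  for p :: "real \<times> real"
  by (simp add: dist_norm flip: zero_prod_def)

text \<open>
  The sine is increasing on \<open>(-\<pi>/2, \<pi>/2)\<close>, and \<open>sin (Arg z) = Im z / cmod z\<close>.
\<close>

lemma Arg_less_on_right_half_circle:
  assumes "norm (x, y) = t" "norm (x', y') = t" "0 < x" "0 < x'" "y < y'"
  shows "Arg (Complex x y) < Arg (Complex x' y')"
proof -
  have bnd: "\<bar>Arg (Complex u v)\<bar> < pi / 2" if "0 < u" for u v
    using that Re_Ln_pos_lt[of "Complex u v"] by (auto simp: Arg_eq_Im_Ln complex_eq_iff)
  have sin: "sin (Arg (Complex u v)) = v / t" if "0 < u" "norm (u, v) = t" for u v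
    using that sin_Arg[of "Complex u v"] by (auto simp: complex_eq_iff norm_Pair cmod_def)
  have "t > 0" using assms(1,3) by (auto simp: norm_Pair intro!: real_sqrt_gt_zero add_pos_nonneg)
  then have "sin (Arg (Complex x y)) < sin (Arg (Complex x' y'))"
    using assms by (simp add: sin divide_strict_right_mono)
  then show ?thesis
    using sin_mono_less_eq[of "Arg (Complex x y)" "Arg (Complex x' y')"] bnd[of x y] bnd[of x' y'] assms(3,4)
    by (simp add: abs_less_iff)
qed

context right_branches
begin

definition pt :: "nat \<Rightarrow> real \<Rightarrow> real \<times> real" where
  "pt i x = (x, Y i x)"

definition half_branch :: "nat \<Rightarrow> real \<Rightarrow> (real \<times> real) set" where
  "half_branch i r = {pt i x | x. x \<in> {0<..<\<delta>} \<and> norm (pt i x) < r}"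

lemma pt_critical:
  assumes "x \<in> {0<..<\<delta>}" "i \<in> {1..n}"
  shows "poly_xy (pderiv F) (pt i x) = 0"
  using roots[OF assms(1) bound[OF assms]] assms(2) by (auto simp: pt_def)

lemma continuous_pt: "i \<in> {1..n} \<Longrightarrow> continuous_on {0<..<\<delta>} (pt i)"
  unfolding pt_def by (intro continuous_intros cont)

lemma tendsto_pt: "i \<in> {1..n} \<Longrightarrow> (pt i \<longlongrightarrow> (0, 0)) (at_right 0)"
  unfolding pt_def by (intro tendsto_intros lim)

lemma height_tendsto_0: "i \<in> {1..n} \<Longrightarrow> ((\<lambda>x. poly_xy F (pt i x)) \<longlongrightarrow> 0) (at_right 0)"
  using isCont_tendsto_compose[OF isCont_poly_xy tendsto_pt, of i F] zero_at_origin by simp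

lemma continuous_height: "i \<in> {1..n} \<Longrightarrow> continuous_on {0<..<\<delta>} (\<lambda>x. poly_xy F (pt i x))"
  unfolding pt_def by (intro continuous_intros cont)

lemma radius_tendsto_0: "i \<in> {1..n} \<Longrightarrow> ((\<lambda>x. norm (pt i x)) \<longlongrightarrow> 0) (at_right 0)"
  using tendsto_norm[OF tendsto_pt, of i] by (simp flip: zero_prod_def)

lemma continuous_radius: "i \<in> {1..n} \<Longrightarrow> continuous_on {0<..<\<delta>} (\<lambda>x. norm (pt i x))"
  by (intro continuous_intros continuous_pt)

lemma pt_inj:
  assumes "x \<in> {0<..<\<delta>}" "i \<in> {1..n}" "j \<in> {1..n}" "pt i x = pt j x'"
  shows "i = j" "x = x'"
proof -
  show "x = x'" using assms(4) by (simp add: pt_def)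
  then have "Y i x = Y j x" using assms(4) by (simp add: pt_def)
  then show "i = j" using ordered[of x i j] ordered[of x j i] assms(1-3) by (cases i j rule: linorder_cases) auto
qed

lemma in_box:
  assumes "norm p < r" "r \<le> \<delta>" "r \<le> \<eta>"
  shows "\<bar>fst p\<bar> < \<delta>" "\<bar>snd p\<bar> < \<eta>"
  using assms norm_fst_le[of "fst p" "snd p"] norm_snd_le[of "snd p" "fst p"] by auto

lemma half_branch_critical:
  assumes "p \<in> half_branch i r" "i \<in> {1..n}"
  shows "p \<in> polar_curve (poly_xy F) \<inter> ball (0, 0) r - {(0, 0)}" "0 < fst p"
  using assms pt_critical unfolding half_branch_def
  by (auto simp: polar_curve_poly_xy mem_ball_origin simp del: mem_ball) (auto simp: pt_def)

lemma critical_in_half_branch: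
  assumes p: "p \<in> polar_curve (poly_xy F)" "norm p < r" "0 < fst p" and r: "r \<le> \<delta>" "r \<le> \<eta>"
  obtains i where "i \<in> {1..n}" "p \<in> half_branch i r"
proof -
  have x: "fst p \<in> {0<..<\<delta>}" using in_box[OF p(2) r] p(3) by simp
  have "poly_xy (pderiv F) (fst p, snd p) = 0" using p(1) by (simp add: polar_curve_poly_xy)
  then obtain i where "i \<in> {1..n}" "snd p = Y i (fst p)"
    using roots[OF x in_box(2)[OF p(2) r]] by auto
  then have "p = pt i (fst p)" by (simp add: pt_def prod_eq_iff)
  then show ?thesis using x p(2) \<open>i \<in> {1..n}\<close> by (intro that[of i]) (auto simp: half_branch_def)
qed

lemma half_branches_disjoint:
  assumes "p \<in> half_branch i r" "p \<in> half_branch j r" "i \<in> {1..n}" "j \<in> {1..n}"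
  shows "i = j"
  using assms pt_inj unfolding half_branch_def by blast

text \<open>
  The radius is increasing along the branch, so the disc cuts it in the image of an interval.
\<close>

lemma connected_half_branch:
  assumes i: "i \<in> {1..n}"
  shows "connected (half_branch i r)"
proof -
  define S where "S = {x \<in> {0<..<\<delta>}. norm (pt i x) < r}"
  have "is_interval S"
    unfolding is_interval_1
  proof (intro ballI allI impI)
    fix a b x assume ab: "a \<in> S" "b \<in> S" and x: "a \<le> x \<and> x \<le> b"
    then have x': "x \<in> {0<..<\<delta>}" by (auto simp: S_def)
    have "norm (pt i x) \<le> norm (pt i b)"
      using radius_mono[OF x' _ i, of b] ab(2) x by (cases "x = b") (auto simp: S_def pt_def)
    then show "x \<in> S" using x' ab(2) by (auto simp: S_def)
  qed
  then have "connected (pt i ` S)"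
    by (intro connected_continuous_image is_interval_connected continuous_on_subset[OF continuous_pt[OF i]])
      (auto simp: S_def)
  moreover have "pt i ` S = half_branch i r" by (auto simp: S_def half_branch_def)
  ultimately show ?thesis by simp
qed

lemma half_branch_nonempty:
  assumes i: "i \<in> {1..n}" and r: "0 < r"
  shows "half_branch i r \<noteq> {}"
proof -
  have "\<forall>\<^sub>F x in at_right 0. norm (pt i x) < r"
    by (rule order_tendstoD(2)[OF radius_tendsto_0[OF i] r])
  moreover have "\<forall>\<^sub>F x in at_right 0. x \<in> {0<..<\<delta>}"
    by (rule eventually_at_rightI[of 0 \<delta>]) (use \<delta> in auto)
  ultimately have "\<forall>\<^sub>F x in at_right 0. norm (pt i x) < r \<and> x \<in> {0<..<\<delta>}"
    by (rule eventually_conj)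
  from eventually_happens'[OF trivial_limit_at_right_real this] show ?thesis
    unfolding half_branch_def by blast
qed

lemma closedin_half_branch:
  assumes i: "i \<in> {1..n}" and H: "H \<subseteq> ball (0, 0) r" "H \<subseteq> {p. 0 < fst p}" and r: "r \<le> \<delta>" "r \<le> \<eta>"
  shows "closedin (top_of_set H) (H \<inter> half_branch i r)"
proof -
  have sub: "norm p < r" "fst p \<in> {0<..<\<delta>}" if "p \<in> H" for p
  proof -
    show "norm p < r" using H(1) that mem_ball_origin by blast
    from in_box(1)[OF this r] H(2) that show "fst p \<in> {0<..<\<delta>}" by auto
  qed
  have "continuous_on H (\<lambda>p. Y i (fst p) - snd p)"
    by (intro continuous_intros continuous_on_compose2[OF cont[OF i]]) (use sub in auto)
  then have "closedin (top_of_set H) {p \<in> H. Y i (fst p) - snd p = 0}"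
    by (rule continuous_closedin_preimage_constant)
  moreover have "H \<inter> half_branch i r = {p \<in> H. Y i (fst p) - snd p = 0}"
  proof (intro equalityI subsetI)
    fix p assume p: "p \<in> {p \<in> H. Y i (fst p) - snd p = 0}"
    then have "p = pt i (fst p)" by (simp add: pt_def prod_eq_iff)
    then show "p \<in> H \<inter> half_branch i r" using p sub[of p] by (auto simp: half_branch_def)
  qed (auto simp: half_branch_def pt_def)
  ultimately show ?thesis by simp
qed

text \<open>
  The finitely many half-branches are disjoint and closed in the component, which is connected.
\<close>

lemma right_component_is_half_branch:
  assumes H: "H \<in> polar_half_branches (poly_xy F) r" "H \<subseteq> {p. 0 < fst p}" and r: "r \<le> \<delta>" "r \<le> \<eta>"
  shows "\<exists>i\<in>{1..n}. H = half_branch i r"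
proof -
  define S where "S = polar_curve (poly_xy F) \<inter> ball (0, 0) r - {(0, 0)}"
  have HS: "H \<in> components S" using H(1) by (simp add: polar_half_branches_def S_def)
  have Hsub: "H \<subseteq> S" "H \<noteq> {}" "connected H"
    using HS in_components_subset in_components_nonempty in_components_connected by blast+
  have cov: "\<exists>i\<in>{1..n}. p \<in> half_branch i r" if "p \<in> H" for p
  proof (rule critical_in_half_branch[of p r])
    show "norm p < r" using that Hsub(1) mem_ball_origin unfolding S_def by blast
  qed (use that Hsub(1) H(2) r S_def in auto)
  obtain p where p: "p \<in> H" using Hsub by blast
  with cov obtain i where i: "i \<in> {1..n}" "p \<in> half_branch i r" by blast
  define B where "B = (\<Union>j\<in>{1..n} - {i}. H \<inter> half_branch j r)"
  have ball: "H \<subseteq> ball (0, 0) r" using Hsub(1) by (auto simp: S_def)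
  have "closedin (top_of_set H) (H \<inter> half_branch i r)"
    by (rule closedin_half_branch[OF i(1) ball H(2) r])
  moreover have "closedin (top_of_set H) B"
    unfolding B_def by (intro closedin_Union) (auto intro!: closedin_half_branch[OF _ ball H(2) r])
  moreover have "(H \<inter> half_branch i r) \<union> B = H"
    using cov by (auto simp: B_def)
  moreover have "(H \<inter> half_branch i r) \<inter> B = {}"
    using half_branches_disjoint i(1) by (auto simp: B_def)
  moreover have "H \<inter> half_branch i r \<noteq> {}" using p i by blast
  ultimately have "B = {}" using Hsub(3) unfolding connected_closedin_eq by blast
  with \<open>(H \<inter> half_branch i r) \<union> B = H\<close> have "H \<subseteq> half_branch i r" by blast
  moreover have "half_branch i r \<subseteq> H"
  proof (rule components_maximal[OF HS connected_half_branch[OF i(1)]])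
    show "half_branch i r \<subseteq> S" using half_branch_critical(1)[OF _ i(1)] by (auto simp: S_def)
    show "H \<inter> half_branch i r \<noteq> {}" using p i by blast
  qed
  ultimately show ?thesis using i(1) by blast
qed

text \<open>
  The component that contains the half-branch cannot leave the half-plane: it would have to cross the
  axis \<open>x = 0\<close> away from the origin, where \<open>f\<^sub>y \<noteq> 0\<close>.
\<close>

lemma half_branch_is_right_component:
  assumes i: "i \<in> {1..n}" and r: "0 < r" "r \<le> \<delta>" "r \<le> \<eta>"
  shows "half_branch i r \<in> right_polar_half_branches (poly_xy F) r"
proof -
  define S where "S = polar_curve (poly_xy F) \<inter> ball (0, 0) r - {(0, 0)}"
  have sub: "half_branch i r \<subseteq> S" using half_branch_critical(1)[OF _ i] by (auto simp: S_def)
  have ne: "half_branch i r \<noteq> {}" by (rule half_branch_nonempty[OF i r(1)])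
  obtain H where H: "H \<in> components S" "half_branch i r \<subseteq> H"
    using exists_component_superset[OF sub _ connected_half_branch[OF i]] sub ne by blast
  have HS: "H \<subseteq> S" using H(1) in_components_subset by blast
  have "0 < fst p" if p: "p \<in> H" for p
  proof (rule ccontr)
    assume np: "\<not> 0 < fst p"
    obtain q where q: "q \<in> half_branch i r" using ne by blast
    then have "0 < fst q" "q \<in> H" using half_branch_critical(2)[OF _ i] H(2) by auto
    moreover have "connected (fst ` H)"
      by (intro connected_continuous_image continuous_intros in_components_connected[OF H(1)])
    ultimately have "0 \<in> fst ` H"
      using connectedD_interval[of "fst ` H" "fst p" "fst q" 0] np p by auto
    then obtain w where w: "w \<in> H" "fst w = 0" by force
    then have wS: "w \<in> polar_curve (poly_xy F)" "norm w < r" "w \<noteq> (0, 0)"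
      using HS mem_ball_origin[of w r] unfolding S_def by blast+
    have "poly_xy (pderiv F) (0, snd w) = 0"
      using wS(1) w(2) by (auto simp: polar_curve_poly_xy) (metis prod.collapse)
    moreover have "snd w \<noteq> 0" using w(2) wS(3) by (metis prod.collapse)
    ultimately show False using axis in_box(2)[OF wS(2) r(2,3)] by blast
  qed
  then have right: "H \<subseteq> {p. 0 < fst p}" by blast
  have "H \<in> polar_half_branches (poly_xy F) r" using H(1) by (simp add: polar_half_branches_def S_def)
  with right_component_is_half_branch[OF _ right r(2,3)] obtain j
    where j: "j \<in> {1..n}" "H = half_branch j r" by blast
  then have "i = j" using H(2) ne half_branches_disjoint i by blast
  then show ?thesis using j \<open>H \<in> polar_half_branches (poly_xy F) r\<close> right
    by (simp add: right_polar_half_branches_def)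
qed

lemma bij_betw_half_branches:
  assumes r: "0 < r" "r \<le> \<delta>" "r \<le> \<eta>"
  shows "bij_betw (\<lambda>i. half_branch i r) {1..n} (right_polar_half_branches (poly_xy F) r)"
  unfolding bij_betw_def
proof
  show "inj_on (\<lambda>i. half_branch i r) {1..n}"
    using half_branch_nonempty[OF _ r(1)] half_branches_disjoint by (intro inj_onI) blast
  show "(\<lambda>i. half_branch i r) ` {1..n} = right_polar_half_branches (poly_xy F) r"
    using half_branch_is_right_component[OF _ r] right_component_is_half_branch[OF _ _ r(2,3)]
    unfolding right_polar_half_branches_def by blast
qed

lemma half_branch_Int_sphere:
  assumes i: "i \<in> {1..n}" and a: "a \<in> {0<..<\<delta>}" "norm (pt i a) = t" and t: "t < r"
  shows "half_branch i r \<inter> sphere (0, 0) t = {pt i a}"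
proof -
  have "x = a" if "x \<in> {0<..<\<delta>}" "norm (pt i x) = t" for x
    using radius_mono[OF that(1) a(1) i] radius_mono[OF a(1) that(1) i] that(2) a(2)
    by (cases x a rule: linorder_cases) (auto simp: pt_def)
  then have "p = pt i a" if "p \<in> half_branch i r" "norm p = t" for p
    using that unfolding half_branch_def by blast
  moreover have "pt i a \<in> half_branch i r" using a t unfolding half_branch_def by blast
  ultimately show ?thesis using a(2) mem_sphere_origin by blast
qed

text \<open>
  Suppose that on a circle of radius \<open>t\<close> the point of the \<open>i\<close>-th half-branch is not below that of the
  \<open>j\<close>-th.  The \<open>i\<close>-th point lies below the graph of \<open>Y j\<close>, whereas the points of the circle near its top
  \<open>(0, t)\<close> lie above it.  The arc between them then meets the \<open>j\<close>-th half-branch, strictly above the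
  \<open>i\<close>-th point and hence above the \<open>j\<close>-th, although the circle meets that half-branch only once.
\<close>

lemma trig_less_half_branches:
  assumes i: "i \<in> {1..n}" and j: "j \<in> {1..n}" and ij: "i < j" and r: "0 < r"
  shows "trig_less (half_branch i r) (half_branch j r)"
proof -
  have mid: "\<delta> / 2 \<in> {0<..<\<delta>}" using \<delta> by simp
  have npos: "0 < norm (pt k (\<delta> / 2))" for k using \<delta> by (simp add: pt_def zero_prod_def)
  define T where "T = Min {r, \<delta>, norm (pt i (\<delta> / 2)), norm (pt j (\<delta> / 2))}"
  have T: "0 < T" using r \<delta> npos by (simp add: T_def)
  show ?thesis
    unfolding trig_less_def
  proof (rule eventually_at_rightI[of 0 T, OF _ T])
    fix t assume "t \<in> {0<..<T}"
    then have t: "0 < t" "t < r" "t < \<delta>" "t < norm (pt i (\<delta> / 2))" "t < norm (pt j (\<delta> / 2))"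
      by (simp_all add: T_def)
    obtain a where "a \<in> {0<..<\<delta> / 2}" "norm (pt i a) = t"
      using attained_near_0[OF continuous_radius[OF i] radius_tendsto_0[OF i] mid t(1,4)] by blast
    then have a: "a \<in> {0<..<\<delta>}" "norm (pt i a) = t" using \<delta> by auto
    obtain b where "b \<in> {0<..<\<delta> / 2}" "norm (pt j b) = t"
      using attained_near_0[OF continuous_radius[OF j] radius_tendsto_0[OF j] mid t(1,5)] by blast
    then have b: "b \<in> {0<..<\<delta>}" "norm (pt j b) = t" using \<delta> by auto
    have "Y i a < Y j b"
    proof (rule ccontr)
      assume "\<not> Y i a < Y j b"
      \<comment> \<open>The height of a point of the right half-circle, given by its ordinate, over the graph of \<open>Y j\<close>.\<close>
      define k where "k y = y - Y j (sqrt (t\<^sup>2 - y\<^sup>2))" for y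
      have absY: "\<bar>Y i a\<bar> < t"
      proof -
        have "(Y i a)\<^sup>2 < t\<^sup>2" using a by (auto simp: pt_def norm_Pair)
        then show ?thesis using t(1) power2_less_imp_less[of "\<bar>Y i a\<bar>" t] by simp
      qed
      have sq: "sqrt (t\<^sup>2 - y\<^sup>2) \<in> {0<..<\<delta>}" if "y \<in> {Y i a..<t}" for y
      proof -
        have "\<bar>y\<bar> < t" using that absY by auto
        then have "y\<^sup>2 < t\<^sup>2" using abs_le_square_iff[of t y] t(1) by (simp add: not_le[symmetric])
        moreover have "sqrt (t\<^sup>2 - y\<^sup>2) \<le> sqrt (t\<^sup>2)" by (intro real_sqrt_le_mono) simp
        ultimately show ?thesis using t by simp
      qed
      have "Y j b < t"
      proof -
        have "(Y j b)\<^sup>2 < t\<^sup>2" using b by (auto simp: pt_def norm_Pair)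
        then show ?thesis using t(1) power2_less_imp_less[of "Y j b" t] by simp
      qed
      have "((\<lambda>y. sqrt (t\<^sup>2 - y\<^sup>2)) \<longlongrightarrow> sqrt (t\<^sup>2 - t\<^sup>2)) (at_left t)" by (intro tendsto_intros)
      then have "((\<lambda>y. sqrt (t\<^sup>2 - y\<^sup>2)) \<longlongrightarrow> 0) (at_left t)" by simp
      moreover have near_t: "\<forall>\<^sub>F y in at_left t. y \<in> {Y i a<..<t}"
        by (rule eventually_at_leftI[of "Y i a"]) (use absY in auto)
      then have "\<forall>\<^sub>F y in at_left t. sqrt (t\<^sup>2 - y\<^sup>2) \<in> {0<..}"
        by eventually_elim (use sq in force)
      ultimately have "filterlim (\<lambda>y. sqrt (t\<^sup>2 - y\<^sup>2)) (at_right 0) (at_left t)"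
        by (auto simp: filterlim_at elim!: eventually_mono)
      from filterlim_compose[OF lim[OF j] this]
      have "(k \<longlongrightarrow> t - 0) (at_left t)" unfolding k_def by (intro tendsto_intros)
      then have "\<forall>\<^sub>F y in at_left t. 0 < k y" using t(1) by (intro order_tendstoD(1)) auto
      then have "\<forall>\<^sub>F y in at_left t. 0 < k y \<and> y \<in> {Y i a<..<t}" using near_t by (rule eventually_conj)
      from eventually_happens'[OF trivial_limit_at_left_real this]
      obtain c where c: "0 < k c" "c \<in> {Y i a<..<t}" by blast
      have "sqrt (t\<^sup>2 - (Y i a)\<^sup>2) = a" using a by (auto simp: pt_def norm_Pair)
      then have "k (Y i a) < 0" using ordered[OF a(1) i j ij] by (simp add: k_def)
      moreover have "continuous_on {Y i a..c} k"
        unfolding k_def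
        by (intro continuous_intros continuous_on_compose2[OF cont[OF j]]) (use sq c in auto)
      ultimately obtain y where y: "Y i a \<le> y" "y \<le> c" "k y = 0"
        using IVT'[of k "Y i a" 0 c] c by auto
      define x where "x = sqrt (t\<^sup>2 - y\<^sup>2)"
      have x: "x \<in> {0<..<\<delta>}" unfolding x_def by (rule sq) (use y c in auto)
      then have "t\<^sup>2 - y\<^sup>2 > 0" unfolding x_def by simp
      then have "norm (pt j x) = t" using y(3) t(1) by (simp add: pt_def norm_Pair x_def k_def)
      then have "pt j x = pt j b"
        using half_branch_Int_sphere[OF j x _ t(2)] half_branch_Int_sphere[OF j b t(2)] by auto
      then have "Y j b = y" using y(3) by (simp add: pt_def x_def k_def)
      with \<open>\<not> Y i a < Y j b\<close> y(1) have "Y i a = y" by simp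
      with y(3) \<open>k (Y i a) < 0\<close> show False by simp
    qed
    then have "Arg (Complex (fst (pt i a)) (snd (pt i a))) < Arg (Complex (fst (pt j b)) (snd (pt j b)))"
      using a b by (intro Arg_less_on_right_half_circle[of _ _ t]) (auto simp: pt_def)
    then show "\<exists>p q. half_branch i r \<inter> sphere (0, 0) t = {p} \<and> half_branch j r \<inter> sphere (0, 0) t = {q} \<and>
        Arg (Complex (fst p) (snd p)) < Arg (Complex (fst q) (snd q))"
      using half_branch_Int_sphere[OF i a t(2)] half_branch_Int_sphere[OF j b t(2)] by blast
  qed
qed

end

section \<open>Level curves at turning points and at regular points\<close>

lemma poly_xy_has_deriv_x:
  "((\<lambda>s. poly_xy F (s, y)) has_real_derivative poly_xy (map_poly pderiv F) (x, y)) (at x)"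
  using poly_xy_along_curve[of "\<lambda>_. y" 0 x F] by simp

lemma level_disc_subset: "level_disc f \<epsilon> \<subseteq> f -` {0..\<epsilon>}"
  by (simp add: level_disc_def connected_component_subset)

text \<open>
  The way to show that points belong to a component: connect them to a known point of it.
\<close>

lemma level_disc_absorbs:
  assumes "connected T" "T \<subseteq> f -` {0..\<epsilon>}" "p \<in> T" "p \<in> level_disc f \<epsilon>"
  shows "T \<subseteq> level_disc f \<epsilon>"
  using connected_component_maximal[OF assms(3,1,2)] connected_component_eq[of p "f -` {0..\<epsilon>}" "(0, 0)"] assms(4)
  by (simp add: level_disc_def)

text \<open>
  Say \<open>s = 1\<close>.  On the vertical line \<open>f\<close> has a strict minimum \<open>\<epsilon>\<close> at \<open>y0\<close>, and \<open>f\<close> increases to the right.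
  So \<open>f > \<epsilon>\<close> for \<open>x \<ge> x0\<close>, except at the point itself, and the level set stays to the left.  For \<open>s = -1\<close> the
  picture is reversed.
\<close>

lemma level_curve_at_turning_point:
  assumes val: "poly_xy F (x0, y0) = \<epsilon>" and fy: "poly_xy (pderiv F) (x0, y0) = 0"
    and fx: "poly_xy (map_poly pderiv F) (x0, y0) > 0"
    and s: "s = 1 \<or> s = -1" and fyy: "s * poly_xy (pderiv (pderiv F)) (x0, y0) > 0"
  shows "\<exists>e>0. \<forall>x y. \<bar>x - x0\<bar> < e \<longrightarrow> \<bar>y - y0\<bar> < e \<longrightarrow> poly_xy F (x, y) = \<epsilon> \<longrightarrow> (x, y) \<noteq> (x0, y0) \<longrightarrow>
    s * (x - x0) < 0"
proof -
  obtain e1 where e1: "e1 > 0" "\<And>x y. \<bar>x - x0\<bar> < e1 \<Longrightarrow> \<bar>y - y0\<bar> < e1 \<Longrightarrow> poly_xy (map_poly pderiv F) (x, y) > 0"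
    using poly_xy_pos_nearby[of 1 "map_poly pderiv F" x0 y0] fx by auto
  obtain e2 where e2: "e2 > 0" "\<And>x y. \<bar>x - x0\<bar> < e2 \<Longrightarrow> \<bar>y - y0\<bar> < e2 \<Longrightarrow> s * poly_xy (pderiv (pderiv F)) (x, y) > 0"
    using poly_xy_pos_nearby[OF fyy] by blast
  define e where "e = min e1 e2"
  have fy_incr: "s * poly_xy (pderiv F) (x0, y) < s * poly_xy (pderiv F) (x0, y')"
    if "y < y'" "\<bar>y - y0\<bar> < e" "\<bar>y' - y0\<bar> < e" for y y'
  proof (rule DERIV_pos_imp_increasing[OF that(1)])
    fix t assume "y \<le> t" "t \<le> y'"
    then have "\<bar>t - y0\<bar> < e" using that by linarith
    then have "s * poly_xy (pderiv (pderiv F)) (x0, t) > 0" using e2 by (auto simp: e_def)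
    then show "\<exists>d. ((\<lambda>a. s * poly_xy (pderiv F) (x0, a)) has_real_derivative d) (at t) \<and> 0 < d"
      using DERIV_cmult[OF poly_xy_has_deriv_y] by blast
  qed
  have vert: "s * \<epsilon> < s * poly_xy F (x0, y)" if "\<bar>y - y0\<bar> < e" "y \<noteq> y0" for y
  proof (cases "y0 < y")
    case True
    from MVT2[OF this, of "\<lambda>t. poly_xy F (x0, t)" "\<lambda>t. poly_xy (pderiv F) (x0, t)"] poly_xy_has_deriv_y
    obtain z where z: "y0 < z" "z < y" "poly_xy F (x0, y) - poly_xy F (x0, y0) = (y - y0) * poly_xy (pderiv F) (x0, z)"
      by blast
    have "s * poly_xy (pderiv F) (x0, z) > 0" using fy_incr[of y0 z] fy z that by auto
    then have "(y - y0) * (s * poly_xy (pderiv F) (x0, z)) > 0" using True by simp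
    also have "\<dots> = s * (poly_xy F (x0, y) - \<epsilon>)" using z(3) val by simp
    finally show ?thesis by (simp add: algebra_simps)
  next
    case False
    then have "y < y0" using that by simp
    from MVT2[OF this, of "\<lambda>t. poly_xy F (x0, t)" "\<lambda>t. poly_xy (pderiv F) (x0, t)"] poly_xy_has_deriv_y
    obtain z where z: "y < z" "z < y0" "poly_xy F (x0, y0) - poly_xy F (x0, y) = (y0 - y) * poly_xy (pderiv F) (x0, z)"
      by blast
    have "s * poly_xy (pderiv F) (x0, z) < 0" using fy_incr[of z y0] fy z that by auto
    then have "(y0 - y) * (s * poly_xy (pderiv F) (x0, z)) < 0" using \<open>y < y0\<close> by (simp add: mult_pos_neg)
    moreover have "(y0 - y) * (s * poly_xy (pderiv F) (x0, z)) = s * (\<epsilon> - poly_xy F (x0, y))" using z(3) val by simp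
    ultimately show ?thesis by (simp add: algebra_simps)
  qed
  have horiz: "poly_xy F (x, y) < poly_xy F (x', y)"
    if "x < x'" "\<bar>x - x0\<bar> < e" "\<bar>x' - x0\<bar> < e" "\<bar>y - y0\<bar> < e" for x x' y
  proof (rule DERIV_pos_imp_increasing[OF that(1)])
    fix t assume "x \<le> t" "t \<le> x'"
    then have "\<bar>t - x0\<bar> < e" using that by linarith
    then have "poly_xy (map_poly pderiv F) (t, y) > 0" using e1 that by (auto simp: e_def)
    then show "\<exists>d. ((\<lambda>a. poly_xy F (a, y)) has_real_derivative d) (at t) \<and> 0 < d"
      using poly_xy_has_deriv_x by blast
  qed
  have e: "e > 0" using e1 e2 by (simp add: e_def)
  have main: "s * (x - x0) < 0"
    if xy: "\<bar>x - x0\<bar> < e" "\<bar>y - y0\<bar> < e" "poly_xy F (x, y) = \<epsilon>" "(x, y) \<noteq> (x0, y0)" for x y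
  proof (rule ccontr)
    assume neg: "\<not> s * (x - x0) < 0"
    have le: "s * \<epsilon> \<le> s * poly_xy F (x0, y)" and lt: "y \<noteq> y0 \<Longrightarrow> s * \<epsilon> < s * poly_xy F (x0, y)"
      using vert[OF xy(2)] val by (cases "y = y0"; force)+
    show False
    proof (cases "x = x0")
      case True
      then show False using lt xy by auto
    next
      case False
      from s show False
      proof
        assume "s = 1"
        then show False using horiz[of x0 x y] neg False xy le e by auto
      next
        assume "s = -1"
        then show False using horiz[of x x0 y] neg False xy le e by auto
      qed
    qed
  qed
  show ?thesis using e main by blast
qed

text \<open>
  Where \<open>f\<^sub>y \<noteq> 0\<close>, the set \<open>f \<le> \<epsilon>\<close> is locally the region on one side of a graph over the \<open>x\<close>-axis.
  This region is connected, so it belongs to the level disc together with the given point; the points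
  of the graph are limits of points with \<open>f > \<epsilon>\<close>, so they are not interior to the disc.
\<close>

lemma level_curve_at_regular_point:
  assumes C: "(x0, y0) \<in> level_curve (poly_xy F) \<epsilon>" and val: "poly_xy F (x0, y0) = \<epsilon>" and \<epsilon>: "\<epsilon> > 0"
    and s: "s = 1 \<or> s = -1" and fy: "s * poly_xy (pderiv F) (x0, y0) > 0" and e: "e > 0"
  shows "\<exists>d>0. \<forall>x. \<bar>x - x0\<bar> < d \<longrightarrow> (\<exists>y. \<bar>y - y0\<bar> < e \<and> (x, y) \<in> level_curve (poly_xy F) \<epsilon>)"
proof -
  obtain e1 where e1: "e1 > 0" "\<And>x y. \<bar>x - x0\<bar> < e1 \<Longrightarrow> \<bar>y - y0\<bar> < e1 \<Longrightarrow> s * poly_xy (pderiv F) (x, y) > 0"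
    using poly_xy_pos_nearby[OF fy] by blast
  obtain e2 where e2: "e2 > 0" "\<And>x y. \<bar>x - x0\<bar> < e2 \<Longrightarrow> \<bar>y - y0\<bar> < e2 \<Longrightarrow> poly_xy F (x, y) > 0"
    using poly_xy_pos_nearby[of 1 F x0 y0] val \<epsilon> by auto
  define h where "h = min e (min e1 e2) / 2"
  have h: "0 < h" "h < e" "h < e1" "h < e2" using e e1 e2 by (auto simp: h_def)
  \<comment> \<open>The vertical coordinate is oriented by \<open>s\<close>, so that \<open>f\<close> increases with \<open>v\<close> in both cases.\<close>
  define g where "g x v = poly_xy F (x, y0 + s * v)" for x v
  have abs: "\<bar>y0 + s * v - y0\<bar> = \<bar>v\<bar>" for v using s by auto
  have incr: "g x v < g x v'" if x: "\<bar>x - x0\<bar> < e1" and v: "v < v'" "-h \<le> v" "v' \<le> h" for x v v'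
  proof (rule DERIV_pos_imp_increasing[OF v(1)])
    fix t assume "v \<le> t" "t \<le> v'"
    then have "\<bar>t\<bar> < e1" using v h by linarith
    then have "s * poly_xy (pderiv F) (x, y0 + s * t) > 0" using e1(2)[OF x] abs by simp
    moreover have "((\<lambda>v. y0 + s * v) has_real_derivative s) (at t)"
      by (auto intro!: derivative_eq_intros)
    from DERIV_chain2[OF poly_xy_has_deriv_y this, of F x]
    have "(g x has_real_derivative poly_xy (pderiv F) (x, y0 + s * t) * s) (at t)"
      by (simp add: g_def[abs_def])
    ultimately show "\<exists>d. (g x has_real_derivative d) (at t) \<and> 0 < d"
      by (auto simp: mult.commute)
  qed
  have g0: "g x0 0 = \<epsilon>" by (simp add: g_def val)
  have "g x0 h > \<epsilon>" "g x0 (- h) < \<epsilon>"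
    using incr[of x0 0 h] incr[of x0 "- h" 0] g0 h e1 by auto
  then have up: "1 * poly_xy (F - [:[:\<epsilon>:]:]) (x0, y0 + s * h) > 0"
    and down: "(- 1) * poly_xy (F - [:[:\<epsilon>:]:]) (x0, y0 + s * (- h)) > 0"
    by (simp_all add: g_def)
  obtain d1 where d1: "d1 > 0" "\<And>x. \<bar>x - x0\<bar> < d1 \<Longrightarrow> g x h > \<epsilon>"
    using poly_xy_pos_nearby[OF up] by (fastforce simp: g_def)
  obtain d2 where d2: "d2 > 0" "\<And>x. \<bar>x - x0\<bar> < d2 \<Longrightarrow> g x (- h) < \<epsilon>"
    using poly_xy_pos_nearby[OF down] by (fastforce simp: g_def)
  define d where "d = Min {d1, d2, e1, e2}"
  have d: "d > 0" "d \<le> d1" "d \<le> d2" "d \<le> e1" "d \<le> e2" using d1 d2 e1 e2 by (simp_all add: d_def)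
  define \<Phi> where "\<Phi> p = (fst p, y0 + s * snd p)" for p :: "real \<times> real"
  \<comment> \<open>The bottom edge of the box with a vertical segment on it: a connected piece of \<open>f \<le> \<epsilon>\<close>.\<close>
  define T where "T x v = \<Phi> ` ({x0 - d<..<x0 + d} \<times> {- h} \<union> {x} \<times> {- h..v})" for x v
  have disc: "(x, y0 + s * v) \<in> level_disc (poly_xy F) \<epsilon>"
    if x: "\<bar>x - x0\<bar> < d" and v: "- h \<le> v" "v \<le> h" and le: "g x v \<le> \<epsilon>" for x v
  proof -
    have conn: "connected (T x v)" if "\<bar>x - x0\<bar> < d" "- h \<le> v" for x v
      unfolding T_def \<Phi>_def
    proof (intro connected_continuous_image continuous_intros connected_Un connected_Times)
      have "(x, - h) \<in> {x0 - d<..<x0 + d} \<times> {- h} \<inter> {x} \<times> {- h..v}" using that by auto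
      then show "{x0 - d<..<x0 + d} \<times> {- h} \<inter> {x} \<times> {- h..v} \<noteq> {}" by blast
    qed auto
    have sub: "T x v \<subseteq> poly_xy F -` {0..\<epsilon>}"
      if x: "\<bar>x - x0\<bar> < d" and v: "- h \<le> v" "v \<le> h" "g x v \<le> \<epsilon>" for x v
    proof
      fix q assume "q \<in> T x v"
      then obtain x' v' where w: "(x', v') \<in> {x0 - d<..<x0 + d} \<times> {- h} \<union> {x} \<times> {- h..v}" "q = \<Phi> (x', v')"
        unfolding T_def by fast
      then have q: "q = (x', y0 + s * v')" by (simp add: \<Phi>_def)
      have cases: "(\<bar>x' - x0\<bar> < d \<and> v' = - h) \<or> (x' = x \<and> - h \<le> v' \<and> v' \<le> v)"
        using w(1) by (auto simp: abs_less_iff)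
      have "g x' v' \<le> \<epsilon>"
        using cases
      proof
        assume "\<bar>x' - x0\<bar> < d \<and> v' = - h"
        then show ?thesis using d2(2)[of x'] d by auto
      next
        assume c: "x' = x \<and> - h \<le> v' \<and> v' \<le> v"
        then have "g x v' \<le> g x v" using incr[of x v' v] x v d by (cases "v' = v") auto
        then show ?thesis using c v by simp
      qed
      moreover have "\<bar>x' - x0\<bar> < e2" "\<bar>v'\<bar> < e2" using cases x v h d by auto
      then have "0 < poly_xy F (x', y0 + s * v')" using e2(2) abs by simp
      ultimately show "q \<in> poly_xy F -` {0..\<epsilon>}" by (simp add: q g_def)
    qed
    have "(x0, - h) \<in> {x0 - d<..<x0 + d} \<times> {- h}" using d by simp
    then have "\<Phi> (x0, - h) \<in> T x0 0 \<inter> T x v" unfolding T_def by blast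
    then have "connected (T x0 0 \<union> T x v)"
      using conn[of x0 0] conn[OF x v(1)] d h by (intro connected_Un) auto
    moreover have "T x0 0 \<union> T x v \<subseteq> poly_xy F -` {0..\<epsilon>}"
      using sub[of x0 0] sub[OF x v le] d h g0 by auto
    moreover have "\<Phi> (x0, 0) \<in> T x0 0"
      unfolding T_def using h by (intro imageI) auto
    then have "(x0, y0) \<in> T x0 0 \<union> T x v" by (simp add: \<Phi>_def)
    moreover have "(x0, y0) \<in> level_disc (poly_xy F) \<epsilon>" using C by (simp add: level_curve_def)
    ultimately have "T x0 0 \<union> T x v \<subseteq> level_disc (poly_xy F) \<epsilon>" by (rule level_disc_absorbs)
    moreover have "\<Phi> (x, v) \<in> T x v" unfolding T_def using v by (intro imageI) auto
    ultimately show ?thesis by (auto simp: \<Phi>_def)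
  qed
  have "\<exists>y. \<bar>y - y0\<bar> < e \<and> (x, y) \<in> level_curve (poly_xy F) \<epsilon>" if x: "\<bar>x - x0\<bar> < d" for x
  proof -
    have "continuous_on {- h..h} (g x)" unfolding g_def by (intro continuous_intros)
    moreover have "g x (- h) < \<epsilon>" "\<epsilon> < g x h" using d1(2)[of x] d2(2)[of x] x d by auto
    ultimately obtain v where v: "- h \<le> v" "v \<le> h" "g x v = \<epsilon>"
      using IVT'[of "g x" "- h" \<epsilon> h] h by auto
    have "v \<noteq> h" using v \<open>\<epsilon> < g x h\<close> by auto
    have "(x, y0 + s * v) \<notin> interior (level_disc (poly_xy F) \<epsilon>)"
    proof
      assume "(x, y0 + s * v) \<in> interior (level_disc (poly_xy F) \<epsilon>)"
      from box_in_open[OF open_interior this] obtain a where a: "a > 0"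
        "\<And>x' y'. \<bar>x' - x\<bar> < a \<Longrightarrow> \<bar>y' - (y0 + s * v)\<bar> < a \<Longrightarrow> (x', y') \<in> interior (level_disc (poly_xy F) \<epsilon>)"
        by blast
      define v' where "v' = min h (v + a / 2)"
      have v': "v < v'" "v' \<le> h" "v' - v < a" using \<open>v \<noteq> h\<close> v a by (auto simp: v'_def)
      have "\<bar>y0 + s * v' - (y0 + s * v)\<bar> < a" using s v' by auto
      then have "(x, y0 + s * v') \<in> level_disc (poly_xy F) \<epsilon>"
        using a(1) a(2)[of x] interior_subset by fastforce
      then have "g x v' \<le> \<epsilon>" using level_disc_subset[of "poly_xy F" \<epsilon>] by (auto simp: g_def)
      moreover have "g x v < g x v'" using incr[of x v v'] v v' x d by auto
      ultimately show False using v by simp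
    qed
    moreover have "(x, y0 + s * v) \<in> level_disc (poly_xy F) \<epsilon>" using disc[OF x v(1,2)] v(3) by simp
    moreover have "\<bar>y0 + s * v - y0\<bar> < e" using abs v h by auto
    ultimately show ?thesis unfolding level_curve_def by blast
  qed
  then show ?thesis using d(1) by blast
qed

text \<open>
  At a point with \<open>f\<^sub>y \<noteq> 0\<close> the level curve continues to both sides of the vertical line.
\<close>

lemma crest_or_valley_imp_critical:
  assumes p: "right_crest (level_curve (poly_xy F) \<epsilon>) p \<or> right_valley (level_curve (poly_xy F) \<epsilon>) p"
    and val: "poly_xy F p = \<epsilon>" and \<epsilon>: "\<epsilon> > 0"
  shows "poly_xy (pderiv F) p = 0"
proof (rule ccontr)
  assume nz: "poly_xy (pderiv F) p \<noteq> 0"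
  obtain x0 y0 where p0: "p = (x0, y0)" by (cases p)
  define s where "s = sgn (poly_xy (pderiv F) p)"
  have s: "s = 1 \<or> s = -1" "s * poly_xy (pderiv F) (x0, y0) > 0"
    using nz by (auto simp: s_def p0 sgn_if)
  have C: "(x0, y0) \<in> level_curve (poly_xy F) \<epsilon>" using p by (auto simp: right_crest_def right_valley_def p0)
  have both: "\<exists>q\<in>level_curve (poly_xy F) \<epsilon>. q \<noteq> p \<and> dist q p < a \<and> fst q < x0"
    "\<exists>q\<in>level_curve (poly_xy F) \<epsilon>. q \<noteq> p \<and> dist q p < a \<and> x0 < fst q" if a: "a > 0" for a
  proof -
    obtain d where d: "d > 0"
      "\<And>x. \<bar>x - x0\<bar> < d \<Longrightarrow> \<exists>y. \<bar>y - y0\<bar> < a / 2 \<and> (x, y) \<in> level_curve (poly_xy F) \<epsilon>"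
      using level_curve_at_regular_point[OF C _ \<epsilon> s, of "a / 2"] val a by (auto simp: p0)
    define u where "u = min d a / 2"
    have u: "0 < u" "u < d" "u \<le> a / 2" using a d by (auto simp: u_def)
    have near: "dist (x, y) p < a" if "\<bar>x - x0\<bar> \<le> u" "\<bar>y - y0\<bar> < a / 2" for x y
      using that u norm_Pair_le[of "x - x0" "y - y0"] by (simp add: p0 dist_norm)
    from d(2)[of "x0 - u"] u obtain y1 where "\<bar>y1 - y0\<bar> < a / 2" "(x0 - u, y1) \<in> level_curve (poly_xy F) \<epsilon>" by auto
    then show "\<exists>q\<in>level_curve (poly_xy F) \<epsilon>. q \<noteq> p \<and> dist q p < a \<and> fst q < x0"
      using u near by (intro bexI[of _ "(x0 - u, y1)"]) (auto simp: p0)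
    from d(2)[of "x0 + u"] u obtain y2 where "\<bar>y2 - y0\<bar> < a / 2" "(x0 + u, y2) \<in> level_curve (poly_xy F) \<epsilon>" by auto
    then show "\<exists>q\<in>level_curve (poly_xy F) \<epsilon>. q \<noteq> p \<and> dist q p < a \<and> x0 < fst q"
      using u near by (intro bexI[of _ "(x0 + u, y2)"]) (auto simp: p0)
  qed
  from p show False
  proof
    assume "right_crest (level_curve (poly_xy F) \<epsilon>) p"
    then obtain a where "a > 0" "\<forall>q\<in>level_curve (poly_xy F) \<epsilon>. q \<noteq> p \<and> dist q p < a \<longrightarrow> x0 < fst q"
      by (auto simp: right_crest_def eventually_at p0)
    with both(1)[of a] show False by force
  next
    assume "right_valley (level_curve (poly_xy F) \<epsilon>) p"
    then obtain a where "a > 0" "\<forall>q\<in>level_curve (poly_xy F) \<epsilon>. q \<noteq> p \<and> dist q p < a \<longrightarrow> fst q < x0"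
      by (auto simp: right_valley_def eventually_at p0)
    with both(2)[of a] show False by force
  qed
qed

section \<open>Orders and permutations of points with alternating abscissae\<close>

lemma branch_order_strict_linear:
  assumes "inj_on P {1..n}"
  shows "strict_linear_order_on (P ` {1..n}) (branch_order n P)"
  unfolding strict_linear_order_on_def
proof (intro conjI)
  have P: "P i = P j \<longleftrightarrow> i = j" if "i \<in> {1..n}" "j \<in> {1..n}" for i j
    using inj_on_eq_iff[OF assms that] .
  have mem: "(p, q) \<in> branch_order n P \<longleftrightarrow> (\<exists>i\<in>{1..n}. \<exists>j\<in>{1..n}. p = P i \<and> q = P j \<and> i < j)" for p q
    unfolding branch_order_def by blast
  show "trans (branch_order n P)"
  proof (rule transI)
    fix p q w assume "(p, q) \<in> branch_order n P" "(q, w) \<in> branch_order n P"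
    then obtain i j j' k where "i \<in> {1..n}" "j \<in> {1..n}" "j' \<in> {1..n}" "k \<in> {1..n}"
      "p = P i" "q = P j" "i < j" "q = P j'" "w = P k" "j' < k" unfolding mem by blast
    moreover from this have "j = j'" using P by blast
    ultimately show "(p, w) \<in> branch_order n P" unfolding mem using less_trans by blast
  qed
  show "irrefl (branch_order n P)"
    unfolding irrefl_def mem using P by blast
  show "total_on (P ` {1..n}) (branch_order n P)"
    unfolding total_on_def
  proof (intro ballI impI)
    fix p q assume "p \<in> P ` {1..n}" "q \<in> P ` {1..n}" "p \<noteq> q"
    then obtain i j where ij: "i \<in> {1..n}" "j \<in> {1..n}" "p = P i" "q = P j" "i \<noteq> j" by blast
    then have "i < j \<or> j < i" by linarith
    with ij show "(p, q) \<in> branch_order n P \<or> (q, p) \<in> branch_order n P"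
      unfolding mem by blast
  qed
qed

lemma abscissa_order_strict_linear:
  assumes "inj_on (\<lambda>i. fst (P i)) {1..n}"
  shows "strict_linear_order_on (P ` {1..n}) (abscissa_order n P)"
  unfolding strict_linear_order_on_def
proof (intro conjI)
  show "trans (abscissa_order n P)"
  proof (rule transI)
    fix p q w assume "(p, q) \<in> abscissa_order n P" "(q, w) \<in> abscissa_order n P"
    then obtain i j j' k where "i \<in> {1..n}" "k \<in> {1..n}" "p = P i" "q = P j" "q = P j'" "w = P k"
      "fst (P j) < fst (P i)" "fst (P k) < fst (P j')" unfolding abscissa_order_def by blast
    moreover from this have "fst (P k) < fst (P i)" by simp
    ultimately show "(p, w) \<in> abscissa_order n P" unfolding abscissa_order_def by blast
  qed
  show "irrefl (abscissa_order n P)"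
    unfolding abscissa_order_def irrefl_def by fastforce
  show "total_on (P ` {1..n}) (abscissa_order n P)"
    unfolding total_on_def
  proof (intro ballI impI)
    fix p q assume "p \<in> P ` {1..n}" "q \<in> P ` {1..n}" "p \<noteq> q"
    then obtain i j where ij: "i \<in> {1..n}" "j \<in> {1..n}" "p = P i" "q = P j" by blast
    then have "fst (P i) \<noteq> fst (P j)" using \<open>p \<noteq> q\<close> inj_onD[OF assms] by blast
    then have "fst (P j) < fst (P i) \<or> fst (P i) < fst (P j)" by linarith
    with ij show "(p, q) \<in> abscissa_order n P \<or> (q, p) \<in> abscissa_order n P"
      unfolding abscissa_order_def by blast
  qed
qed

text \<open>
  The position of a point in the branch order is its index, and its position in the abscissa order
  counts the points to its right.  So the permutation reverses abscissae: \<open>\<sigma> i < \<sigma> j\<close> holds if and only if the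
  \<open>j\<close>-th point lies to the left of the \<open>i\<close>-th.
\<close>

lemma snake_of_alternating_abscissae:
  fixes P :: "nat \<Rightarrow> real \<times> real"
  assumes inj: "inj_on (\<lambda>i. fst (P i)) {1..n}"
    and alt: "\<And>i. 1 \<le> i \<Longrightarrow> i < n \<Longrightarrow> fst (P (i + 1)) < fst (P i) \<longleftrightarrow> (odd i \<longleftrightarrow> b)"
  shows "snake n (assoc_permutation (P ` {1..n}) (branch_order n P) (abscissa_order n P))"
proof -
  define \<sigma> where "\<sigma> = assoc_permutation (P ` {1..n}) (branch_order n P) (abscissa_order n P)"
  have injP: "inj_on P {1..n}" by (rule inj_on_imageI2[of fst]) (use inj in \<open>simp add: o_def\<close>)
  have Peq: "P i = P j \<longleftrightarrow> i = j" if "i \<in> {1..n}" "j \<in> {1..n}" for i j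
    using inj_on_eq_iff[OF injP that] .
  have pos1: "order_position (P ` {1..n}) (branch_order n P) (P i) = i" if i: "i \<in> {1..n}" for i
  proof -
    have "(P j, P i) \<in> branch_order n P \<longleftrightarrow> j < i" if "j \<in> {1..n}" for j
      using i that Peq unfolding branch_order_def by blast
    then have "{q \<in> P ` {1..n}. (q, P i) \<in> branch_order n P} = P ` {j \<in> {1..n}. j < i}" by blast
    moreover have "{j \<in> {1..n}. j < i} = {1..<i}" using i by auto
    moreover have "card (P ` {1..<i}) = i - 1"
      using i by (subst card_image) (auto intro: inj_on_subset[OF injP])
    ultimately show ?thesis using i by (simp add: order_position_def)
  qed
  have pos2: "order_position (P ` {1..n}) (abscissa_order n P) (P i) = card {j \<in> {1..n}. fst (P i) < fst (P j)} + 1"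
    if i: "i \<in> {1..n}" for i
  proof -
    have "(P j, P i) \<in> abscissa_order n P \<longleftrightarrow> fst (P i) < fst (P j)" if "j \<in> {1..n}" for j
      using i that Peq unfolding abscissa_order_def by blast
    then have "{q \<in> P ` {1..n}. (q, P i) \<in> abscissa_order n P} = P ` {j \<in> {1..n}. fst (P i) < fst (P j)}"
      by blast
    moreover have "card (P ` {j \<in> {1..n}. fst (P i) < fst (P j)}) = card {j \<in> {1..n}. fst (P i) < fst (P j)}"
      by (rule card_image) (auto intro: inj_on_subset[OF injP])
    ultimately show ?thesis by (simp add: order_position_def)
  qed
  have \<sigma>: "\<sigma> i = card {j \<in> {1..n}. fst (P i) < fst (P j)} + 1" if i: "i \<in> {1..n}" for i
  proof -
    have "(THE a. a \<in> P ` {1..n} \<and> order_position (P ` {1..n}) (branch_order n P) a = i) = P i"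
      using i pos1 by (intro the_equality) auto
    then show ?thesis by (simp only: \<sigma>_def assoc_permutation_def pos2[OF i])
  qed
  have mono: "\<sigma> i < \<sigma> j" if ij: "i \<in> {1..n}" "j \<in> {1..n}" "fst (P j) < fst (P i)" for i j
  proof -
    have "{k \<in> {1..n}. fst (P i) < fst (P k)} \<subset> {k \<in> {1..n}. fst (P j) < fst (P k)}"
      using ij by fastforce
    then have "card {k \<in> {1..n}. fst (P i) < fst (P k)} < card {k \<in> {1..n}. fst (P j) < fst (P k)}"
      by (intro psubset_card_mono) auto
    then show ?thesis using \<sigma> ij by simp
  qed
  have ne: "fst (P i) \<noteq> fst (P j)" if "i \<in> {1..n}" "j \<in> {1..n}" "i \<noteq> j" for i j
    using inj_onD[OF inj] that by blast
  have less: "\<sigma> i < \<sigma> j \<longleftrightarrow> fst (P j) < fst (P i)" if ij: "i \<in> {1..n}" "j \<in> {1..n}" for i j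
    using mono[OF ij] mono[OF ij(2,1)] ne[OF ij] by (cases "i = j") (auto simp: neq_iff)
  have bij: "bij_betw \<sigma> {1..n} {1..n}"
    unfolding bij_betw_def
  proof
    show inj\<sigma>: "inj_on \<sigma> {1..n}"
    proof (rule inj_onI, rule ccontr)
      fix i j assume ij: "i \<in> {1..n}" "j \<in> {1..n}" "\<sigma> i = \<sigma> j" "i \<noteq> j"
      then have "fst (P i) < fst (P j) \<or> fst (P j) < fst (P i)" using ne[of i j] by linarith
      then show False using mono ij by fastforce
    qed
    show "\<sigma> ` {1..n} = {1..n}"
    proof (rule endo_inj_surj)
      show "\<sigma> ` {1..n} \<subseteq> {1..n}"
      proof
        fix k assume "k \<in> \<sigma> ` {1..n}"
        then obtain i where i: "i \<in> {1..n}" "k = \<sigma> i" by blast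
        have "i \<notin> {j \<in> {1..n}. fst (P i) < fst (P j)}" by simp
        then have "{j \<in> {1..n}. fst (P i) < fst (P j)} \<subset> {1..n}" using i(1) by blast
        then have "card {j \<in> {1..n}. fst (P i) < fst (P j)} < card {1..n}"
          by (intro psubset_card_mono) simp_all
        then show "k \<in> {1..n}" using i \<sigma>[OF i(1)] by simp
      qed
    qed (use inj\<sigma> in auto)
  qed
  have alternating: "(if odd i \<longleftrightarrow> b then \<sigma> i < \<sigma> (i + 1) else \<sigma> i > \<sigma> (i + 1))" if i: "1 \<le> i" "i < n" for i
  proof -
    have ii: "i \<in> {1..n}" "i + 1 \<in> {1..n}" using i by auto
    have "fst (P i) \<noteq> fst (P (i + 1))" using ne[OF ii] by simp
    then show ?thesis using alt[OF i] less[OF ii] less[OF ii(2,1)] by (cases "odd i \<longleftrightarrow> b") auto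
  qed
  then have "(\<forall>i. 1 \<le> i \<and> i < n \<longrightarrow> (if odd i then \<sigma> i > \<sigma> (i + 1) else \<sigma> i < \<sigma> (i + 1))) \<or>
      (\<forall>i. 1 \<le> i \<and> i < n \<longrightarrow> (if odd i then \<sigma> i < \<sigma> (i + 1) else \<sigma> i > \<sigma> (i + 1)))"
  proof (cases b)
    case True
    have "if odd i then \<sigma> i < \<sigma> (i + 1) else \<sigma> i > \<sigma> (i + 1)" if i: "1 \<le> i" "i < n" for i
      using alternating[OF i] True by (cases "odd i") simp_all
    then show ?thesis by blast
  next
    case False
    have "if odd i then \<sigma> i > \<sigma> (i + 1) else \<sigma> i < \<sigma> (i + 1)" if i: "1 \<le> i" "i < n" for i
      using alternating[OF i] False by (cases "odd i") simp_all
    then show ?thesis by blast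
  qed
  with bij show ?thesis unfolding snake_def \<sigma>_def[symmetric] by blast
qed

section \<open>Small level curves and the snake\<close>

context right_branches
begin

lemma nonneg_near_origin:
  assumes "norm p < r" "r \<le> \<delta>" "r \<le> \<eta>"
  shows "poly_xy F p \<ge> 0"
proof (cases "p = (0, 0)")
  case False
  then show ?thesis using pos[OF in_box[OF assms]] by (simp add: less_imp_le)
qed (simp add: zero_at_origin)

text \<open>
  On a circle around the origin \<open>f\<close> has a positive minimum.  Below that height the connected level disc
  cannot cross the circle.
\<close>

lemma level_disc_small:
  assumes r: "0 < r" "r \<le> \<delta>" "r \<le> \<eta>"
  shows "\<exists>\<epsilon>0>0. \<forall>\<epsilon>. 0 < \<epsilon> \<and> \<epsilon> < \<epsilon>0 \<longrightarrow> level_disc (poly_xy F) \<epsilon> \<subseteq> ball (0, 0) r"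
proof -
  \<comment> \<open>The circle of radius \<open>r / 2\<close> rather than \<open>r\<close> lies inside the open box where \<open>f\<close> is positive.\<close>
  define K where "K = sphere (0 :: real, 0 :: real) (r / 2)"
  have "continuous_on K (poly_xy F)"
    by (intro continuous_at_imp_continuous_on ballI isCont_poly_xy)
  moreover have "compact K" by (simp add: K_def)
  moreover have "K \<noteq> {}"
  proof -
    have "(r / 2, 0) \<in> K" using r by (simp add: K_def mem_sphere_origin norm_Pair del: mem_sphere)
    then show ?thesis by blast
  qed
  ultimately obtain m where m: "m \<in> K" "\<And>q. q \<in> K \<Longrightarrow> poly_xy F m \<le> poly_xy F q"
    using continuous_attains_inf[of K "poly_xy F"] by blast
  have nm: "norm m = r / 2" using m(1) unfolding K_def mem_sphere_origin .
  then have "m \<noteq> (0, 0)" using r by (auto simp flip: zero_prod_def)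
  moreover have "norm m < r" using nm r by simp
  ultimately have mpos: "poly_xy F m > 0"
    using pos[OF in_box[of m r]] r by simp
  have "level_disc (poly_xy F) \<epsilon> \<subseteq> ball (0, 0) r" if \<epsilon>: "0 < \<epsilon>" "\<epsilon> < poly_xy F m" for \<epsilon>
  proof -
    have "level_disc (poly_xy F) \<epsilon> \<inter> frontier (ball (0, 0) (r / 2)) = {}"
      using m(2) \<epsilon> level_disc_subset[of "poly_xy F" \<epsilon>] r by (force simp: K_def)
    moreover have "connected (level_disc (poly_xy F) \<epsilon>)" by (simp add: level_disc_def)
    moreover have "(0, 0) \<in> level_disc (poly_xy F) \<epsilon>" using zero_at_origin \<epsilon> by (simp add: level_disc_def)
    then have "level_disc (poly_xy F) \<epsilon> \<inter> ball (0, 0) (r / 2) \<noteq> {}"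
      using r by (auto intro!: exI[of _ 0])
    ultimately have "level_disc (poly_xy F) \<epsilon> \<subseteq> ball (0, 0) (r / 2)"
      using connected_Int_frontier[of "level_disc (poly_xy F) \<epsilon>" "ball (0, 0) (r / 2)"] by blast
    also have "\<dots> \<subseteq> ball (0, 0) r" using r by (intro subset_ball) simp
    finally show ?thesis .
  qed
  with mpos show ?thesis by blast
qed

text \<open>
  A point of the level disc with \<open>f < \<epsilon>\<close> has a whole ball around it in \<open>0 \<le> f \<le> \<epsilon>\<close>, and the component
  absorbs this ball.
\<close>

lemma level_curve_value:
  assumes p: "p \<in> level_curve (poly_xy F) \<epsilon>" and D: "level_disc (poly_xy F) \<epsilon> \<subseteq> ball (0, 0) r"
    and r: "r \<le> \<delta>" "r \<le> \<eta>"
  shows "poly_xy F p = \<epsilon>"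
proof (rule ccontr)
  assume ne: "poly_xy F p \<noteq> \<epsilon>"
  have pD: "p \<in> level_disc (poly_xy F) \<epsilon>" using p by (simp add: level_curve_def)
  then have lt: "poly_xy F p < \<epsilon>" using ne level_disc_subset[of "poly_xy F" \<epsilon>] by force
  have "open (poly_xy F -` {..<\<epsilon>})"
    by (rule continuous_open_vimage) (auto intro: isCont_poly_xy)
  then have "open (poly_xy F -` {..<\<epsilon>} \<inter> ball (0, 0) r)" by (intro open_Int) auto
  moreover have "p \<in> poly_xy F -` {..<\<epsilon>} \<inter> ball (0, 0) r" using lt pD D by auto
  ultimately obtain a where a: "a > 0" "ball p a \<subseteq> poly_xy F -` {..<\<epsilon>} \<inter> ball (0, 0) r"
    by (meson openE)
  have "ball p a \<subseteq> poly_xy F -` {0..\<epsilon>}"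
  proof
    fix q assume "q \<in> ball p a"
    then have q: "poly_xy F q < \<epsilon>" "q \<in> ball (0, 0) r" using a(2) by auto
    from q(2) have "norm q < r" unfolding mem_ball_origin .
    with q(1) nonneg_near_origin r show "q \<in> poly_xy F -` {0..\<epsilon>}" by auto
  qed
  then have "ball p a \<subseteq> level_disc (poly_xy F) \<epsilon>"
    using a(1) pD by (intro level_disc_absorbs[of _ _ _ p]) auto
  then have "p \<in> interior (level_disc (poly_xy F) \<epsilon>)" using a(1) by (auto simp: mem_interior)
  then show False using p by (simp add: level_curve_def)
qed

text \<open>
  The height increases along the half-branch.  The part from the origin to the point therefore lies in
  \<open>0 \<le> f \<le> \<epsilon>\<close>, which puts the point into the level disc, and the part beyond it lies in \<open>f > \<epsilon>\<close>, which
  keeps it out of the interior.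
\<close>

lemma pt_in_level_curve:
  assumes i: "i \<in> {1..n}" and x: "x \<in> {0<..<\<delta>}" and val: "poly_xy F (pt i x) = \<epsilon>"
  shows "pt i x \<in> level_curve (poly_xy F) \<epsilon>"
proof -
  have hm: "poly_xy F (pt i u) < poly_xy F (pt i v)" if "0 < u" "u < v" "v < \<delta>" for u v
    using height_mono[of u v i] that i by (simp add: pt_def)
  have hpos: "0 < poly_xy F (pt i u)" if "u \<in> {0<..<\<delta>}" for u
    using pos[of u "Y i u"] bound[OF that i] that by (simp add: pt_def)
  define A where "A = pt i ` {0<..x}"
  have conA: "connected A"
    unfolding A_def
    by (intro connected_continuous_image continuous_on_subset[OF continuous_pt[OF i]]) (use x in auto)
  have evA: "\<forall>\<^sub>F u in at_right 0. pt i u \<in> A"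
    by (rule eventually_at_rightI[of 0 x]) (use x in \<open>auto simp: A_def\<close>)
  have "(0, 0) \<in> closure A"
    by (rule Lim_in_closed_set[OF closed_closure _ trivial_limit_at_right_real tendsto_pt[OF i]])
      (use evA closure_subset[of A] in \<open>auto elim!: eventually_mono\<close>)
  then have con: "connected (insert (0, 0) A)"
    using closure_subset[of A] by (intro connected_intermediate_closure[OF conA]) auto
  have sub: "insert (0, 0) A \<subseteq> poly_xy F -` {0..\<epsilon>}"
  proof -
    have "poly_xy F (pt i u) \<in> {0..\<epsilon>}" if "u \<in> {0<..x}" for u
      using hpos[of u] hm[of u x] that x val by (cases "u = x") auto
    moreover have "0 \<le> \<epsilon>" using hpos[OF x] val by simp
    ultimately show ?thesis using zero_at_origin by (auto simp: A_def)
  qed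
  have "insert (0, 0) A \<subseteq> level_disc (poly_xy F) \<epsilon>"
    unfolding level_disc_def by (rule connected_component_maximal[OF _ con sub]) simp
  moreover have "pt i x \<in> A" using x by (auto simp: A_def)
  ultimately have inD: "pt i x \<in> level_disc (poly_xy F) \<epsilon>" by blast
  have "pt i x \<notin> interior (level_disc (poly_xy F) \<epsilon>)"
  proof
    assume int: "pt i x \<in> interior (level_disc (poly_xy F) \<epsilon>)"
    have "isCont (pt i) x"
      using continuous_pt[OF i] x by (simp add: continuous_on_eq_continuous_at)
    then have "(pt i \<longlongrightarrow> pt i x) (at_right x)"
      unfolding isCont_def by (rule tendsto_mono[rotated]) (simp add: at_le)
    from topological_tendstoD[OF this open_interior int]
    have "\<forall>\<^sub>F u in at_right x. pt i u \<in> interior (level_disc (poly_xy F) \<epsilon>)" .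
    moreover have "\<forall>\<^sub>F u in at_right x. u \<in> {x<..<\<delta>}"
      by (rule eventually_at_rightI[of x \<delta>]) (use x in auto)
    ultimately have "\<forall>\<^sub>F u in at_right x. pt i u \<in> interior (level_disc (poly_xy F) \<epsilon>) \<and> u \<in> {x<..<\<delta>}"
      by (rule eventually_conj)
    from eventually_happens'[OF trivial_limit_at_right_real this]
    obtain u where u: "pt i u \<in> interior (level_disc (poly_xy F) \<epsilon>)" "u \<in> {x<..<\<delta>}" by blast
    then have "pt i u \<in> poly_xy F -` {0..\<epsilon>}" using interior_subset level_disc_subset by blast
    moreover have "\<epsilon> < poly_xy F (pt i u)" using hm[of x u] u(2) x val by auto
    ultimately show False by simp
  qed
  with inD show ?thesis by (simp add: level_curve_def)
qed

lemma level_curve_Int_half_branch: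
  assumes i: "i \<in> {1..n}" and x: "x \<in> {0<..<\<delta>}" and val: "poly_xy F (pt i x) = \<epsilon>"
    and D: "level_disc (poly_xy F) \<epsilon> \<subseteq> ball (0, 0) r" and r: "r \<le> \<delta>" "r \<le> \<eta>"
  shows "level_curve (poly_xy F) \<epsilon> \<inter> half_branch i r = {pt i x}"
proof -
  have C: "pt i x \<in> level_curve (poly_xy F) \<epsilon>" by (rule pt_in_level_curve[OF i x val])
  then have "pt i x \<in> ball (0, 0) r" using D by (auto simp: level_curve_def)
  then have "norm (pt i x) < r" unfolding mem_ball_origin .
  then have "pt i x \<in> half_branch i r" using x unfolding half_branch_def by blast
  moreover have "p = pt i x" if p: "p \<in> level_curve (poly_xy F) \<epsilon>" "p \<in> half_branch i r" for p
  proof -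
    obtain u where u: "p = pt i u" "u \<in> {0<..<\<delta>}" using p(2) unfolding half_branch_def by blast
    have "poly_xy F (pt i u) = poly_xy F (pt i x)"
      using level_curve_value[OF p(1) D r] u(1) val by simp
    then have "u = x" using height_mono[OF u(2) x i] height_mono[OF x u(2) i]
      by (cases u x rule: linorder_cases) (auto simp: pt_def)
    then show ?thesis using u(1) by simp
  qed
  ultimately show ?thesis using C by blast
qed

lemma pt_crest_or_valley:
  assumes i: "i \<in> {1..n}" and x: "x \<in> {0<..<\<delta>}" and val: "poly_xy F (pt i x) = \<epsilon>"
    and D: "level_disc (poly_xy F) \<epsilon> \<subseteq> ball (0, 0) r" and r: "r \<le> \<delta>" "r \<le> \<eta>"
  shows "right_crest (level_curve (poly_xy F) \<epsilon>) (pt i x) \<or> right_valley (level_curve (poly_xy F) \<epsilon>) (pt i x)"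
proof -
  define s where "s = sgn (poly_xy (pderiv (pderiv F)) (x, Y i x))"
  have s: "s = 1 \<or> s = -1" "s * poly_xy (pderiv (pderiv F)) (x, Y i x) > 0"
    using simple[OF x i] by (auto simp: s_def sgn_if)
  obtain e where e: "e > 0" "\<And>u v. \<bar>u - x\<bar> < e \<Longrightarrow> \<bar>v - Y i x\<bar> < e \<Longrightarrow> poly_xy F (u, v) = \<epsilon> \<Longrightarrow>
      (u, v) \<noteq> (x, Y i x) \<Longrightarrow> s * (u - x) < 0"
    using level_curve_at_turning_point[OF _ _ deriv_x_pos[OF x i] s] val pt_critical[OF x i]
    unfolding pt_def by blast
  have near: "\<forall>\<^sub>F q in at (pt i x) within level_curve (poly_xy F) \<epsilon>. s * (fst q - x) < 0"
    unfolding eventually_at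
  proof (intro exI[of _ e] conjI ballI impI e(1))
    fix q assume q: "q \<in> level_curve (poly_xy F) \<epsilon>" and dq: "q \<noteq> pt i x \<and> dist q (pt i x) < e"
    have "poly_xy F q = \<epsilon>" by (rule level_curve_value[OF q D r])
    moreover have "\<bar>fst q - x\<bar> < e" "\<bar>snd q - Y i x\<bar> < e"
      using dist_fst_le[of q "pt i x"] dist_snd_le[of q "pt i x"] dq by (auto simp: pt_def dist_real_def)
    ultimately show "s * (fst q - x) < 0" using e(2)[of "fst q" "snd q"] dq by (simp add: pt_def)
  qed
  have C: "pt i x \<in> level_curve (poly_xy F) \<epsilon>" "0 < fst (pt i x)"
    using pt_in_level_curve[OF i x val] x by (auto simp: pt_def)
  from s(1) show ?thesis
  proof
    assume "s = 1"
    then have "right_valley (level_curve (poly_xy F) \<epsilon>) (pt i x)"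
      using near C by (simp add: right_valley_def) (simp add: pt_def)
    then show ?thesis ..
  next
    assume "s = -1"
    then have "right_crest (level_curve (poly_xy F) \<epsilon>) (pt i x)"
      using near C by (simp add: right_crest_def) (simp add: pt_def)
    then show ?thesis ..
  qed
qed

lemma crests_and_valleys:
  assumes X: "\<And>i. i \<in> {1..n} \<Longrightarrow> X i \<in> {0<..<\<delta>} \<and> poly_xy F (pt i (X i)) = \<epsilon>" and \<epsilon>: "0 < \<epsilon>"
    and D: "level_disc (poly_xy F) \<epsilon> \<subseteq> ball (0, 0) r" and r: "r \<le> \<delta>" "r \<le> \<eta>"
  shows "{p. right_crest (level_curve (poly_xy F) \<epsilon>) p \<or> right_valley (level_curve (poly_xy F) \<epsilon>) p} =
    (\<lambda>i. pt i (X i)) ` {1..n}"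
proof (intro equalityI subsetI)
  fix p assume "p \<in> (\<lambda>i. pt i (X i)) ` {1..n}"
  then show "p \<in> {p. right_crest (level_curve (poly_xy F) \<epsilon>) p \<or> right_valley (level_curve (poly_xy F) \<epsilon>) p}"
    using pt_crest_or_valley[OF _ _ _ D r] X by blast
next
  fix p assume "p \<in> {p. right_crest (level_curve (poly_xy F) \<epsilon>) p \<or> right_valley (level_curve (poly_xy F) \<epsilon>) p}"
  then have p: "right_crest (level_curve (poly_xy F) \<epsilon>) p \<or> right_valley (level_curve (poly_xy F) \<epsilon>) p" by simp
  then have C: "p \<in> level_curve (poly_xy F) \<epsilon>" "0 < fst p" by (auto simp: right_crest_def right_valley_def)
  have "poly_xy (pderiv F) p = 0"
    by (rule crest_or_valley_imp_critical[OF p level_curve_value[OF C(1) D r] \<epsilon>])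
  then have crit: "p \<in> polar_curve (poly_xy F)" by (simp add: polar_curve_poly_xy)
  have "p \<in> ball (0, 0) r" using C(1) D by (auto simp: level_curve_def)
  then have "norm p < r" unfolding mem_ball_origin .
  from critical_in_half_branch[OF crit this C(2) r] obtain i where i: "i \<in> {1..n}" "p \<in> half_branch i r" .
  with C(1) level_curve_Int_half_branch[OF i(1) _ _ D r, of "X i"] X[OF i(1)] have "p = pt i (X i)" by blast
  with i(1) show "p \<in> (\<lambda>i. pt i (X i)) ` {1..n}" by blast
qed

text \<open>
  The sign \<open>s\<close> of \<open>f\<^sub>y\<^sub>y\<close> at the lower root is the sign of \<open>f\<^sub>y\<close> just above it, hence up to the next root, where
  \<open>s f\<^sub>y\<close> comes down to \<open>0\<close>; the root being simple, \<open>s f\<^sub>y\<^sub>y\<close> is negative there.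
\<close>

lemma consecutive_branches:
  assumes i: "i \<in> {1..n}" "Suc i \<in> {1..n}" and x: "x \<in> {0<..<\<delta>}"
    and s: "s * poly_xy (pderiv (pderiv F)) (pt i x) > 0"
  shows "s * poly_xy F (pt i x) < s * poly_xy F (pt (Suc i) x)"
    and "s * poly_xy (pderiv (pderiv F)) (pt (Suc i) x) < 0"
proof -
  define a b where "a = Y i x" and "b = Y (Suc i) x"
  define g where "g y = s * poly_xy (pderiv F) (x, y)" for y
  have ab: "a < b" using ordered[OF x i] by (simp add: a_def b_def)
  have s0: "s \<noteq> 0" using s by auto
  have ga: "g a = 0" and gb: "g b = 0"
    using pt_critical[OF x] i by (simp_all add: g_def a_def b_def pt_def)
  have dg: "(g has_real_derivative s * poly_xy (pderiv (pderiv F)) (x, y)) (at y)" for y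
    unfolding g_def by (rule DERIV_cmult[OF poly_xy_has_deriv_y])
  have nz: "g y \<noteq> 0" if y: "a < y" "y < b" for y
  proof
    assume "g y = 0"
    moreover have "\<bar>y\<bar> < \<eta>" using y bound[OF x i(1)] bound[OF x i(2)] by (auto simp: a_def b_def)
    ultimately obtain k where k: "k \<in> {1..n}" "y = Y k x" using roots[OF x] s0 by (auto simp: g_def)
    have "\<not> k \<le> i" using ordered[OF x k(1) i(1)] k(2) y(1) by (cases "k = i") (auto simp: a_def)
    moreover have "\<not> Suc i \<le> k" using ordered[OF x i(2) k(1)] k(2) y(2) by (cases "k = Suc i") (auto simp: b_def)
    ultimately show False by simp
  qed
  obtain d where d: "d > 0" "\<And>h. 0 < h \<Longrightarrow> h < d \<Longrightarrow> g a < g (a + h)"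
    using DERIV_pos_inc_right[OF dg[of a]] s by (auto simp: a_def pt_def)
  obtain c where "a < c" "c < min b (a + d)" using dense[of a "min b (a + d)"] ab d(1) by auto
  then have c: "a < c" "c < b" "0 < g c" using d(2)[of "c - a"] ga by auto
  have conn: "connected (g ` {a<..<b})"
    unfolding g_def by (intro connected_continuous_image continuous_intros) simp
  have gpos: "0 < g y" if y: "a < y" "y < b" for y
  proof (rule ccontr)
    assume "\<not> 0 < g y"
    then have "0 \<in> g ` {a<..<b}"
      using connectedD_interval[OF conn, of "g y" "g c" 0] c y by auto
    then show False using nz by auto
  qed
  obtain z where z: "a < z" "z < b" "poly_xy F (x, b) - poly_xy F (x, a) = (b - a) * poly_xy (pderiv F) (x, z)"
    using MVT2[OF ab, of "\<lambda>t. poly_xy F (x, t)" "\<lambda>t. poly_xy (pderiv F) (x, t)"] poly_xy_has_deriv_y by blast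
  have "s * (poly_xy F (x, b) - poly_xy F (x, a)) = (b - a) * g z" using z(3) by (simp add: g_def)
  also have "\<dots> > 0" using ab gpos[OF z(1,2)] by simp
  finally show "s * poly_xy F (pt i x) < s * poly_xy F (pt (Suc i) x)"
    by (simp add: pt_def a_def b_def algebra_simps)
  have "\<not> s * poly_xy (pderiv (pderiv F)) (x, b) > 0"
  proof
    assume "s * poly_xy (pderiv (pderiv F)) (x, b) > 0"
    from DERIV_pos_inc_left[OF dg this] obtain d' where d': "d' > 0" "\<And>h. 0 < h \<Longrightarrow> h < d' \<Longrightarrow> g (b - h) < g b"
      by blast
    obtain c' where "max a (b - d') < c'" "c' < b" using dense[of "max a (b - d')" b] ab d'(1) by auto
    then show False using d'(2)[of "b - c'"] gb gpos[of c'] by auto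
  qed
  then show "s * poly_xy (pderiv (pderiv F)) (pt (Suc i) x) < 0"
    using simple[OF x i(2)] s0 by (simp add: pt_def b_def not_less le_less)
qed

text \<open>
  The intermediate value theorem along the branch, on which \<open>f\<^sub>y\<^sub>y\<close> has no zero.  It makes the pattern of
  minima and maxima independent of \<open>x\<close>.
\<close>

lemma second_derivative_sign_constant:
  assumes i: "i \<in> {1..n}" and x: "x \<in> {0<..<\<delta>}" "x' \<in> {0<..<\<delta>}"
    and s: "s * poly_xy (pderiv (pderiv F)) (pt i x) > 0"
  shows "s * poly_xy (pderiv (pderiv F)) (pt i x') > 0"
proof (rule ccontr)
  define g where "g u = s * poly_xy (pderiv (pderiv F)) (pt i u)" for u
  assume "\<not> s * poly_xy (pderiv (pderiv F)) (pt i x') > 0"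
  then have "g x' \<le> 0" "0 \<le> g x" using s by (simp_all add: g_def)
  moreover have "connected (g ` {0<..<\<delta>})"
    unfolding g_def pt_def by (intro connected_continuous_image continuous_intros cont[OF i]) simp
  ultimately have "0 \<in> g ` {0<..<\<delta>}"
    using connectedD_interval[of "g ` {0<..<\<delta>}" "g x'" "g x" 0] x by auto
  then show False using simple[OF _ i] s by (auto simp: g_def pt_def)
qed

text \<open>
  The Boolean \<open>b\<close> records whether the lowest branch consists of minima.
\<close>

lemma heights_alternate:
  obtains b where "\<And>i x. 1 \<le> i \<Longrightarrow> i < n \<Longrightarrow> x \<in> {0<..<\<delta>} \<Longrightarrow>
    poly_xy F (pt i x) < poly_xy F (pt (Suc i) x) \<longleftrightarrow> (odd i \<longleftrightarrow> b)"
proof (cases "n = 0")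
  case False
  have mid: "\<delta> / 2 \<in> {0<..<\<delta>}" using \<delta> by simp
  have one: "1 \<in> {1..n}" using False by simp
  define s where "s = sgn (poly_xy (pderiv (pderiv F)) (pt 1 (\<delta> / 2)))"
  have s: "s = 1 \<or> s = -1" "s * poly_xy (pderiv (pderiv F)) (pt 1 (\<delta> / 2)) > 0"
    using simple[OF mid one] by (auto simp: s_def pt_def sgn_if)
  have sign: "s * (- 1) ^ i * poly_xy (pderiv (pderiv F)) (pt (Suc i) x) > 0"
    if "i < n" "x \<in> {0<..<\<delta>}" for i x
    using that
  proof (induction i)
    case 0
    then show ?case using second_derivative_sign_constant[OF one mid _ s(2)] by simp
  next
    case (Suc i)
    then have "s * (- 1) ^ i * poly_xy (pderiv (pderiv F)) (pt (Suc i) x) > 0" by simp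
    from consecutive_branches(2)[OF _ _ Suc.prems(2) this] Suc.prems show ?case by simp
  qed
  show ?thesis
  proof (rule that[of "s = 1"])
    fix i x assume i: "1 \<le> i" "i < n" and x: "x \<in> {0<..<\<delta>}"
    then obtain j where j: "i = Suc j" by (cases i) auto
    have "s * (- 1) ^ j * poly_xy F (pt i x) < s * (- 1) ^ j * poly_xy F (pt (Suc i) x)"
      using consecutive_branches(1)[of i x "s * (- 1) ^ j"] sign[of j x] i x by (simp add: j)
    then show "poly_xy F (pt i x) < poly_xy F (pt (Suc i) x) \<longleftrightarrow> (odd i \<longleftrightarrow> s = 1)"
      using s(1) by (cases "even j") (auto simp: j)
  qed
qed (use that in auto)

text \<open>
  For \<open>\<epsilon>\<close> below all heights at \<open>\<delta> / 2\<close>, each branch reaches the height \<open>\<epsilon>\<close> at exactly one abscissa \<open>X i\<close>.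
  Comparing two consecutive branches at \<open>X i\<close> decides the order of \<open>X i\<close> and \<open>X (Suc i)\<close>, because the
  height along the upper branch is increasing.
\<close>

lemma shape_is_snake:
  assumes r: "0 < r" "r \<le> \<delta>" "r \<le> \<eta>"
  shows "\<forall>\<^sub>F \<epsilon> in at_right 0. \<exists>P.
      (\<forall>i\<in>{1..n}. level_curve (poly_xy F) \<epsilon> \<inter> half_branch i r = {P i}) \<and>
      {p. right_crest (level_curve (poly_xy F) \<epsilon>) p \<or> right_valley (level_curve (poly_xy F) \<epsilon>) p} = P ` {1..n} \<and>
      strict_linear_order_on (P ` {1..n}) (branch_order n P) \<and>
      strict_linear_order_on (P ` {1..n}) (abscissa_order n P) \<and>
      snake n (assoc_permutation (P ` {1..n}) (branch_order n P) (abscissa_order n P))"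
proof -
  have mid: "\<delta> / 2 \<in> {0<..<\<delta>}" using \<delta> by simp
  obtain \<epsilon>0 where \<epsilon>0: "\<epsilon>0 > 0" "\<And>\<epsilon>. 0 < \<epsilon> \<Longrightarrow> \<epsilon> < \<epsilon>0 \<Longrightarrow> level_disc (poly_xy F) \<epsilon> \<subseteq> ball (0, 0) r"
    using level_disc_small[OF r] by blast
  obtain b where b: "\<And>i x. 1 \<le> i \<Longrightarrow> i < n \<Longrightarrow> x \<in> {0<..<\<delta>} \<Longrightarrow>
    poly_xy F (pt i x) < poly_xy F (pt (Suc i) x) \<longleftrightarrow> (odd i \<longleftrightarrow> b)"
    using heights_alternate by blast
  have "\<forall>\<^sub>F \<epsilon> in at_right 0. \<epsilon> \<in> {0<..<\<epsilon>0}"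
    by (rule eventually_at_rightI[of 0 \<epsilon>0]) (use \<epsilon>0 in auto)
  moreover have "\<forall>\<^sub>F \<epsilon> in at_right 0. \<forall>i\<in>{1..n}. \<epsilon> < poly_xy F (pt i (\<delta> / 2))"
  proof (intro eventually_ball_finite ballI)
    fix i assume i: "i \<in> {1..n}"
    have "0 < poly_xy F (pt i (\<delta> / 2))"
      using pos[of "\<delta> / 2" "Y i (\<delta> / 2)"] bound[OF mid i] \<delta> by (simp add: pt_def)
    then show "\<forall>\<^sub>F \<epsilon> in at_right 0. \<epsilon> < poly_xy F (pt i (\<delta> / 2))"
      by (intro eventually_at_rightI[of 0 "poly_xy F (pt i (\<delta> / 2))"]) auto
  qed simp
  ultimately show ?thesis
  proof eventually_elim
    case (elim \<epsilon>)
    then have \<epsilon>: "0 < \<epsilon>" and D: "level_disc (poly_xy F) \<epsilon> \<subseteq> ball (0, 0) r" using \<epsilon>0(2) by auto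
    have "\<forall>i\<in>{1..n}. \<exists>x. x \<in> {0<..<\<delta>} \<and> poly_xy F (pt i x) = \<epsilon>"
    proof
      fix i assume i: "i \<in> {1..n}"
      have "\<exists>x\<in>{0<..<\<delta> / 2}. poly_xy F (pt i x) = \<epsilon>"
        by (rule attained_near_0[OF continuous_height[OF i] height_tendsto_0[OF i] mid \<epsilon>]) (use elim(2) i in blast)
      then show "\<exists>x. x \<in> {0<..<\<delta>} \<and> poly_xy F (pt i x) = \<epsilon>" using \<delta> by force
    qed
    from bchoice[OF this] obtain X where X: "\<And>i. i \<in> {1..n} \<Longrightarrow> X i \<in> {0<..<\<delta>} \<and> poly_xy F (pt i (X i)) = \<epsilon>"
      by blast
    define P where "P i = pt i (X i)" for i
    have fstP: "fst (P i) = X i" for i by (simp add: P_def pt_def)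
    have inj: "inj_on (\<lambda>i. fst (P i)) {1..n}"
    proof (rule inj_onI)
      fix i j assume ij: "i \<in> {1..n}" "j \<in> {1..n}" "fst (P i) = fst (P j)"
      then have "poly_xy F (X i, Y i (X i)) = poly_xy F (X i, Y j (X i))"
        using X[OF ij(1)] X[OF ij(2)] by (simp add: fstP pt_def)
      then show "i = j" using heights_distinct[of "X i" i j] X[OF ij(1)] ij by blast
    qed
    have order: "X (Suc i) < X i \<longleftrightarrow> poly_xy F (pt i (X i)) < poly_xy F (pt (Suc i) (X i))"
      if i: "1 \<le> i" "i < n" for i
    proof -
      have S: "Suc i \<in> {1..n}" and I: "i \<in> {1..n}" using i by auto
      have "poly_xy F (pt i (X i)) = poly_xy F (pt (Suc i) (X (Suc i)))" using X[OF S] X[OF I] by simp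
      then show ?thesis
        using height_mono[OF _ _ S, of "X i" "X (Suc i)"] height_mono[OF _ _ S, of "X (Suc i)" "X i"] X[OF S] X[OF I]
        by (cases "X i" "X (Suc i)" rule: linorder_cases) (auto simp: pt_def)
    qed
    have injP: "inj_on P {1..n}" by (rule inj_on_imageI2[of fst]) (use inj in \<open>simp add: o_def\<close>)
    have "snake n (assoc_permutation (P ` {1..n}) (branch_order n P) (abscissa_order n P))"
    proof (rule snake_of_alternating_abscissae[OF inj])
      fix i assume i: "1 \<le> i" "i < n"
      then have "X i \<in> {0<..<\<delta>}" using X[of i] by simp
      with order[OF i] b[OF i] show "fst (P (i + 1)) < fst (P i) \<longleftrightarrow> (odd i \<longleftrightarrow> b)" by (simp add: fstP)
    qed
    moreover have "\<forall>i\<in>{1..n}. level_curve (poly_xy F) \<epsilon> \<inter> half_branch i r = {P i}"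
      unfolding P_def using level_curve_Int_half_branch[OF _ _ _ D r(2,3)] X by blast
    moreover have "{p. right_crest (level_curve (poly_xy F) \<epsilon>) p \<or> right_valley (level_curve (poly_xy F) \<epsilon>) p} = P ` {1..n}"
      unfolding P_def by (rule crests_and_valleys[OF X \<epsilon> D r(2,3)])
    ultimately show ?case
      using branch_order_strict_linear[OF injP] abscissa_order_strict_linear[OF inj] by blast
  qed
qed

end

theorem theorem1p4:
  fixes f :: "real \<times> real \<Rightarrow> real" and F :: "real poly poly"
  assumes poly_f: "f = poly_xy F"
    and f_O: "f (0, 0) = 0"
    and min_O: "strict_local_min f (0, 0)"
    and reduced: "squarefree (pderiv F)"
    and homeo: "\<exists>\<psi>. homeomorphism (polar_curve f) (polar_map f ` polar_curve f) (polar_map f) \<psi>"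
  shows "\<forall>\<^sub>F r in at_right 0. \<exists>n \<gamma>.
    bij_betw \<gamma> {1..n} (right_polar_half_branches f r) \<and>
    (\<forall>i\<in>{1..n}. \<forall>j\<in>{1..n}. i < j \<longrightarrow> trig_less (\<gamma> i) (\<gamma> j)) \<and>
    (\<forall>\<^sub>F \<epsilon> in at_right 0. \<exists>P.
      (\<forall>i\<in>{1..n}. level_curve f \<epsilon> \<inter> \<gamma> i = {P i}) \<and>
      {p. right_crest (level_curve f \<epsilon>) p \<or> right_valley (level_curve f \<epsilon>) p} = P ` {1..n} \<and>
      strict_linear_order_on (P ` {1..n}) (branch_order n P) \<and>
      strict_linear_order_on (P ` {1..n}) (abscissa_order n P) \<and>
      snake n (assoc_permutation (P ` {1..n}) (branch_order n P) (abscissa_order n P)))"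
proof -
  have "inj_on (polar_map f) (polar_curve f)"
    using homeo unfolding homeomorphism_def by (metis inj_on_inverseI)
  then obtain \<delta> \<eta> n Y where "right_branches F \<delta> \<eta> n Y"
    using exists_right_branches f_O min_O reduced unfolding poly_f by blast
  then interpret right_branches F \<delta> \<eta> n Y .
  show ?thesis
  proof (rule eventually_at_rightI[of 0 "min \<delta> \<eta>"])
    fix r assume "r \<in> {0<..<min \<delta> \<eta>}"
    then have r: "0 < r" "r \<le> \<delta>" "r \<le> \<eta>" by auto
    show "\<exists>n \<gamma>.
      bij_betw \<gamma> {1..n} (right_polar_half_branches f r) \<and>
      (\<forall>i\<in>{1..n}. \<forall>j\<in>{1..n}. i < j \<longrightarrow> trig_less (\<gamma> i) (\<gamma> j)) \<and>
      (\<forall>\<^sub>F \<epsilon> in at_right 0. \<exists>P.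
        (\<forall>i\<in>{1..n}. level_curve f \<epsilon> \<inter> \<gamma> i = {P i}) \<and>
        {p. right_crest (level_curve f \<epsilon>) p \<or> right_valley (level_curve f \<epsilon>) p} = P ` {1..n} \<and>
        strict_linear_order_on (P ` {1..n}) (branch_order n P) \<and>
        strict_linear_order_on (P ` {1..n}) (abscissa_order n P) \<and>
        snake n (assoc_permutation (P ` {1..n}) (branch_order n P) (abscissa_order n P)))"
      unfolding poly_f
      by (intro exI[of _ n] exI[of _ "\<lambda>i. half_branch i r"] conjI bij_betw_half_branches ballI impI
        trig_less_half_branches shape_is_snake r)
  qed (use \<delta> \<eta> in auto)
qed

end
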